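(* Let $M$ be an open $3$-manifold with end point (Freudenthal) compactification $M^{\ast}$ such that $M^{\ast}\cong S^{3}$ and such that $M^{\ast}\setminus M$ is a Cantor set $C$. If there is an integer $N\geq 3$ such that only finitely many points of $C$ have local genus $N$ (with $C$ regarded as a Cantor set in $M^{\ast}\cong S^3$), then there are uncountably many pairwise nonhomeomorphic open $3$-manifolds, none of them homeomorphic to $M$, that have fundamental group isomorphic to $\pi_1(M)$.
   Context: An open $3$-manifold is a noncompact connected $3$-manifold without boundary. The Freudenthal (end point) compactification $M^\ast$ of $M$ is obtained by adding one point for each end of $M$. Local genus (in $S^3$, defined exactly as in $\mathbb{R}^3$). A defining sequence for a Cantor set $X\subset S^3$ is a sequence $(M_i)_{i\ge 0}$ of compact 3-manifolds with boundary in $S^3$ such that (a) each $M_i$ is a (finite) union of pairwise disjoint cubes with handles (handlebodies, genus $0$ allowed); (b) $M_{i+1}\subset \operatorname{Int} M_i$ for each $i$; (c) $X=\bigcap_i M_i$. Let $\mathcal{D}(X)$ be the set of all defining sequences for $X$. For a handlebody $H$, $g(H)$ is its genus; for a disjoint union of handlebodies $H=\bigsqcup_\lambda H_\lambda$, $g(H)=\sup_\lambda g(H_\lambda)$. For $A\subset X$ and $(M_i)\in\mathcal{D}(X)$, let $M_i^A$ be the union of the components of $M_i$ which intersect $A$. Define $g_A(X;(M_i))=\sup\{g(M_i^A) : i\ge 0\}$ and $g_A(X)=\inf\{g_A(X;(M_i)) : (M_i)\in\mathcal{D}(X)\}$, a nonnegative integer or $\infty$. The local genus of $X$ at $x\in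 X$ is $g_x(X)=g_{\{x\}}(X)$. It is invariant under homeomorphisms of the ambient space, so it makes sense for $C\subset M^\ast\cong S^3$. *)

theory Defs
  imports "HOL-Analysis.Analysis" "HOL-Library.Extended_Nat" "HOL-Algebra.Group"
begin

section \<open>Open 3-manifolds\<close>

definition manifold3 :: "'a topology \<Rightarrow> bool" where
  "manifold3 X \<longleftrightarrow> Hausdorff_space X \<and> second_countable X \<and>
     (\<forall>x\<in>topspace X. \<exists>U (V :: (real^3) set).
        openin X U \<and> x \<in> U \<and> open V \<and> subtopology X U homeomorphic_space top_of_set V)"

definition open_manifold3 :: "'a topology \<Rightarrow> bool" where
  "open_manifold3 X \<longleftrightarrow> manifold3 X \<and> connected_space X \<and> \<not> compact_space X"

section \<open>Ends and the Freudenthal compactification\<close>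

text \<open>An end is an element of the inverse limit of the sets of components of the complements
  of the compact sets, i.e. a choice, compatible with inclusion, of a component of the complement
  of each compact set. It is made a total function by extensionality.\<close>

definition ends :: "'a topology \<Rightarrow> ('a set \<Rightarrow> 'a set) set" where
  "ends X = {e \<in> (\<Pi>\<^sub>E K\<in>Collect (compactin X).
                    connected_components_of (subtopology X (topspace X - K))).
              \<forall>K L. compactin X K \<longrightarrow> compactin X L \<longrightarrow> K \<subseteq> L \<longrightarrow> e L \<subseteq> e K}"

text \<open>Basic neighbourhoods of the end \<open>e\<close> consist, for a compact set \<open>K\<close>, of the component
  \<open>e K\<close> together with all ends lying in that component.\<close>

definition freudenthal :: "'a topology \<Rightarrow> ('a + ('a set \<Rightarrow> 'a set)) topology" where
  "freudenthal X = topology_generated_by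
     ({Inl ` U |U. openin X U} \<union>
      {Inl ` e K \<union> Inr ` {e' \<in> ends X. e' K = e K} |e K. e \<in> ends X \<and> compactin X K})"

lemma topspace_freudenthal:
  "topspace (freudenthal X) = Inl ` topspace X \<union> Inr ` ends X"
proof -
  have sub: "e K \<subseteq> topspace X" if "e \<in> ends X" "compactin X K" for e K
    using that connected_components_of_subset[of "e K" "subtopology X (topspace X - K)"]
    by (auto simp: ends_def PiE_iff)
  let ?A = "{Inl ` U |U. openin X U} :: ('a + ('a set \<Rightarrow> 'a set)) set set"
  let ?B = "{Inl ` e K \<union> Inr ` {e' \<in> ends X. e' K = e K} |e K. e \<in> ends X \<and> compactin X K}"
  have A: "\<Union>?A = Inl ` topspace X"
  proof
    show "\<Union>?A \<subseteq> Inl ` topspace X"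
      using openin_subset by blast
    show "Inl ` topspace X \<subseteq> \<Union>?A"
      using openin_topspace by blast
  qed
  have B1: "\<Union>?B \<subseteq> Inl ` topspace X \<union> Inr ` ends X"
    using sub by blast
  have B2: "Inr ` ends X \<subseteq> \<Union>?B"
  proof clarify
    fix e assume e: "e \<in> ends X"
    have "Inl ` e {} \<union> Inr ` {e' \<in> ends X. e' {} = e {}} \<in> ?B"
      using e compactin_empty by blast
    moreover have "Inr e \<in> Inl ` e {} \<union> Inr ` {e' \<in> ends X. e' {} = e {}}"
      using e by blast
    ultimately show "Inr e \<in> \<Union>?B"
      by (rule UnionI)
  qed
  have "topspace (freudenthal X) = \<Union>?A \<union> \<Union>?B"
    unfolding freudenthal_def topology_generated_by_topspace by (rule Union_Un_distrib)
  also have "\<dots> = Inl ` topspace X \<union> Inr ` ends X"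
    unfolding A by (intro subset_antisym Un_least Un_upper1 B1 Un_mono subset_refl B2)
  finally show ?thesis .
qed

section \<open>Cantor sets and handlebodies\<close>

definition Cantor_set_in :: "'a topology \<Rightarrow> 'a set \<Rightarrow> bool" where
  "Cantor_set_in X C \<longleftrightarrow> C \<subseteq> topspace X \<and>
     subtopology X C homeomorphic_space
       product_topology (\<lambda>_::nat. discrete_topology (UNIV :: bool set)) UNIV"

text \<open>The standard cube with \<open>g\<close> handles: a disk with \<open>g\<close> holes times an interval.\<close>

definition std_handlebody :: "nat \<Rightarrow> (complex \<times> real) set" where
  "std_handlebody g = (cball 0 (real g + 1) - (\<Union>k\<in>{1..g}. ball (of_nat k) (1/4))) \<times> {0..1}"

definition handlebody_in :: "'a topology \<Rightarrow> nat \<Rightarrow> 'a set \<Rightarrow> bool" where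
  "handlebody_in X g H \<longleftrightarrow> H \<subseteq> topspace X \<and>
     subtopology X H homeomorphic_space top_of_set (std_handlebody g)"

text \<open>The components of a finite disjoint union of handlebodies in a Hausdorff space are exactly
  these handlebodies, so this is the largest of their genera.\<close>

definition genus_in :: "'a topology \<Rightarrow> 'a set \<Rightarrow> enat" where
  "genus_in X H = Sup {enat g |g L. L \<in> connected_components_of (subtopology X H) \<and>
                                   handlebody_in X g L}"

section \<open>Local genus\<close>

text \<open>The ambient space \<open>S\<close> is meant to be homeomorphic to the 3-sphere; since all notions
  below are topological, they need no choice of a homeomorphism. In that case the topological
  interior of each \<open>M i\<close> is its manifold interior, by invariance of domain.\<close>

definition defining_sequence :: "'a topology \<Rightarrow> 'a set \<Rightarrow> (nat \<Rightarrow> 'a set) \<Rightarrow> bool" where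
  "defining_sequence S X M \<longleftrightarrow>
     (\<forall>i. \<exists>\<H>. finite \<H> \<and> disjoint \<H> \<and> (\<forall>H\<in>\<H>. \<exists>g. handlebody_in S g H) \<and> M i = \<Union>\<H>) \<and>
     (\<forall>i. M (Suc i) \<subseteq> S interior_of (M i)) \<and>
     X = (\<Inter>i. M i)"

definition components_meeting :: "'a topology \<Rightarrow> 'a set \<Rightarrow> 'a set \<Rightarrow> 'a set" where
  "components_meeting S H A = \<Union>{L \<in> connected_components_of (subtopology S H). L \<inter> A \<noteq> {}}"

definition genus_wrt :: "'a topology \<Rightarrow> 'a set \<Rightarrow> (nat \<Rightarrow> 'a set) \<Rightarrow> enat" where
  "genus_wrt S A M = (SUP i. genus_in S (components_meeting S (M i) A))"

definition genus_at :: "'a topology \<Rightarrow> 'a set \<Rightarrow> 'a set \<Rightarrow> enat" where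
  "genus_at S X A = (INF M\<in>Collect (defining_sequence S X). genus_wrt S A M)"

definition local_genus :: "'a topology \<Rightarrow> 'a set \<Rightarrow> 'a \<Rightarrow> enat" where
  "local_genus S X x = genus_at S X {x}"

section \<open>The fundamental group\<close>

text \<open>The library's homotopy of paths and path concatenation are restricted to type-class
  topologies; these are their analogues for an arbitrary topology.\<close>

definition loops :: "'a topology \<Rightarrow> 'a \<Rightarrow> (real \<Rightarrow> 'a) set" where
  "loops X x = {p. pathin X p \<and> p 0 = x \<and> p 1 = x}"

definition loop_homotopy :: "'a topology \<Rightarrow> 'a \<Rightarrow> ((real \<Rightarrow> 'a) \<times> (real \<Rightarrow> 'a)) set" where
  "loop_homotopy X x = {(p, q). p \<in> loops X x \<and> q \<in> loops X x \<and>
     homotopic_with (\<lambda>r. r 0 = x \<and> r 1 = x) (top_of_set {0..1}) X p q}"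

definition loop_join :: "(real \<Rightarrow> 'a) \<Rightarrow> (real \<Rightarrow> 'a) \<Rightarrow> real \<Rightarrow> 'a" where
  "loop_join p q = (\<lambda>t. if t \<le> 1/2 then p (2 * t) else q (2 * t - 1))"

definition fundamental_group :: "'a topology \<Rightarrow> 'a \<Rightarrow> (real \<Rightarrow> 'a) set monoid" where
  "fundamental_group X x =
     \<lparr>carrier = loops X x // loop_homotopy X x,
      mult = (\<lambda>A B. \<Union>p\<in>A. \<Union>q\<in>B. loop_homotopy X x `` {loop_join p q}),
      one = loop_homotopy X x `` {\<lambda>_. x}\<rparr>"

end

theory Submission
  imports Defs
begin

text \<open>Let \<open>A\<close> be a nonempty countable compact set inside a chart of \<open>M\<close>. Then \<open>M - A\<close> is again an open
  3-manifold, and it has the same fundamental group: loops and homotopies of loops are maps of spaces of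
  dimension at most 2, and in dimension 3 general position moves them off \<open>A\<close>
  (\<open>push_off_countable_set\<close>, \<open>fundamental_group_minus_countable_in_chart\<close>). It remains to show
  that these manifolds fall into uncountably many homeomorphism classes; the one class that may contain \<open>M\<close>
  can then be dropped.

  The manifold \<open>M - A\<close> determines \<open>A\<close> up to homeomorphism. Indeed \<open>M - A\<close> is the complement in the
  3-sphere of the union of \<open>A\<close> and the Cantor set \<open>C\<close> of ends of \<open>M\<close>. This union is compact and totally
  disconnected, and does not locally separate the sphere: near an end of \<open>M\<close> by the
  definition of the Freudenthal topology, elsewhere because a ball minus a countable set is connected.
  Under these conditions every homeomorphism of complements extends to the sphere
  (\<open>homeomorphism_of_complements_extends\<close>), so that it maps the removed sets onto each other. The set \<open>A\<close> is
  the part of the removed set where it is locally countable, as every nonempty open subset of a Cantor set is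
  uncountable (\<open>removed_countable_sets_homeomorphic\<close>).

  Finally, countable compact subsets of a ball have uncountably many homeomorphism types. A countable
  compact set cannot contain two disjoint copies of itself, for iterating them would produce a point for every
  binary sequence. So, given countably many such sets, one that contains two disjoint
  copies of each of them is new (\<open>countable_compact_set_homeomorphic_to_none\<close>).\<close>

section \<open>Charts of 3-manifolds\<close>

lemma homeomorphic_maps_top_of_set:
  "homeomorphic_maps (top_of_set S) (top_of_set T) f g \<longleftrightarrow> homeomorphism S T f g"
proof
  assume l: "homeomorphic_maps (top_of_set S) (top_of_set T) f g"
  show "homeomorphism S T f g"
    by (rule homeomorphismI) (use l in \<open>auto simp: homeomorphic_maps_def\<close>)
next
  assume "homeomorphism S T f g"
  then show "homeomorphic_maps (top_of_set S) (top_of_set T) f g"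
    by (auto simp: homeomorphic_maps_def homeomorphism_def)
qed

lemma homeomorphic_space_top_of_set:
  "top_of_set S homeomorphic_space top_of_set T \<longleftrightarrow> S homeomorphic T"
  by (simp add: homeomorphic_space_def homeomorphic_def homeomorphic_maps_top_of_set)

lemma manifold3_ball_chart:
  fixes X :: "'a topology"
  assumes X: "manifold3 X" and W: "openin X W" and x: "x \<in> W"
  obtains U and v :: "real^3" and r where "openin X U" "x \<in> U" "U \<subseteq> W" "r > 0"
    "subtopology X U homeomorphic_space top_of_set (ball v r)"
proof -
  have "x \<in> topspace X"
    using W x openin_subset by blast
  then obtain U0 and V0 :: "(real^3) set" where U0: "openin X U0" "x \<in> U0" and V0: "open V0"
    and hom: "subtopology X U0 homeomorphic_space top_of_set V0"
    using X unfolding manifold3_def by blast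
  from hom obtain f g where fg: "homeomorphic_maps (subtopology X U0) (top_of_set V0) f g"
    unfolding homeomorphic_space_def by blast
  then have gf: "homeomorphic_maps (top_of_set V0) (subtopology X U0) g f"
    by (rule homeomorphic_maps_sym[THEN iffD1])
  have f: "homeomorphic_map (subtopology X U0) (top_of_set V0) f"
    and g: "homeomorphic_map (top_of_set V0) (subtopology X U0) g"
    using fg gf homeomorphic_maps_map by blast+
  have sub: "U0 \<subseteq> topspace X" using U0 openin_subset by blast
  have "openin (subtopology X U0) (U0 \<inter> W)"
    using W by (simp add: openin_subtopology_Int2)
  then have "openin (top_of_set V0) (f ` (U0 \<inter> W))"
    using f homeomorphic_imp_open_map open_map_def by blast
  then have "open (f ` (U0 \<inter> W))"
    using V0 openin_open_eq by blast
  moreover have "f x \<in> f ` (U0 \<inter> W)" using U0 x by blast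
  ultimately obtain r where r: "r > 0" "ball (f x) r \<subseteq> f ` (U0 \<inter> W)"
    using open_contains_ball by blast
  have fV: "f ` U0 \<subseteq> V0"
    using homeomorphic_imp_surjective_map[OF f] sub by (simp add: Int_absorb1)
  have gfid: "g (f y) = y" if "y \<in> U0" for y
    using fg that sub by (auto simp: homeomorphic_maps_def)
  define U where "U = g ` ball (f x) r"
  have bV: "ball (f x) r \<subseteq> V0" using r fV by blast
  have "openin (top_of_set V0) (ball (f x) r)"
    using bV V0 by (simp add: openin_open_eq)
  then have "openin (subtopology X U0) U"
    unfolding U_def using g homeomorphic_imp_open_map open_map_def by blast
  then have "openin X U"
    using U0 openin_open_subtopology by blast
  moreover have "x \<in> U" unfolding U_def using gfid[OF U0(2)] r(1) by (metis centre_in_ball image_eqI)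
  moreover have UW: "U \<subseteq> U0 \<inter> W" unfolding U_def using r gfid by fastforce
  moreover have "subtopology X U homeomorphic_space top_of_set (ball (f x) r)"
  proof -
    have "homeomorphic_map (subtopology (top_of_set V0) (ball (f x) r)) (subtopology (subtopology X U0) U) g"
      by (rule homeomorphic_map_subtopologies[OF g])
        (use bV sub UW in \<open>auto simp: U_def\<close>)
    moreover have "subtopology (top_of_set V0) (ball (f x) r) = top_of_set (ball (f x) r)"
      using bV by (simp add: subtopology_subtopology inf.absorb2)
    moreover have "subtopology (subtopology X U0) U = subtopology X U"
      using UW by (simp add: subtopology_subtopology inf.absorb2)
    ultimately show ?thesis
      using homeomorphic_map_imp_homeomorphic_space homeomorphic_space_sym by metis
  qed
  ultimately show ?thesis using that r(1) by blast
qed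

lemma manifold3_imp_locally_path_connected:
  assumes X: "manifold3 X" shows "locally_path_connected_space X"
  unfolding locally_path_connected_space
proof (intro allI impI)
  fix V x assume "openin X V \<and> x \<in> V"
  then obtain U and v :: "real^3" and r where U: "openin X U" "x \<in> U" "U \<subseteq> V"
    and hom: "subtopology X U homeomorphic_space top_of_set (ball v r)"
    using manifold3_ball_chart[OF X] by metis
  have "path_connected_space (top_of_set (ball v r))"
    using path_connected_space_topspace_empty  by (simp add: path_connectedin_topspace[symmetric] path_connectedin_subtopology convex_imp_path_connected)
  then have "path_connected_space (subtopology X U)"
    using hom homeomorphic_path_connected_space by blast
  then have "path_connectedin X U"
    using U(1) openin_subset by (auto simp: path_connectedin_def)
  then show "\<exists>U. openin X U \<and> path_connectedin X U \<and> x \<in> U \<and> U \<subseteq> V"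
    using U by blast
qed

lemma manifold3_homeomorphic_space:
  assumes X: "manifold3 X" and hom: "X homeomorphic_space Y"
  shows "manifold3 Y"
  unfolding manifold3_def
proof (intro conjI ballI)
  obtain f where f: "homeomorphic_map X Y f" using hom by (auto simp: homeomorphic_space)
  show "Hausdorff_space Y" using X hom homeomorphic_Hausdorff_space by (auto simp: manifold3_def)
  show "second_countable Y"
    using X hom homeomorphic_space_second_countability by (auto simp: manifold3_def)
  fix y assume "y \<in> topspace Y"
  then obtain x where x: "x \<in> topspace X" "y = f x"
    using homeomorphic_imp_surjective_map[OF f] by blast
  then obtain U and V :: "(real^3) set" where U: "openin X U" "x \<in> U" "open V"
    and UV: "subtopology X U homeomorphic_space top_of_set V"
    using X unfolding manifold3_def by blast
  have sub: "U \<subseteq> topspace X" using U(1) openin_subset by blast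
  have "homeomorphic_map (subtopology X U) (subtopology Y (f ` U)) f"
    by (rule homeomorphic_map_subtopologies[OF f])
      (use sub homeomorphic_imp_surjective_map[OF f] in auto)
  then have "subtopology Y (f ` U) homeomorphic_space top_of_set V"
    using UV homeomorphic_map_imp_homeomorphic_space homeomorphic_space_sym homeomorphic_space_trans by metis
  moreover have "openin Y (f ` U)" using f U(1) homeomorphic_imp_open_map open_map_def by blast
  ultimately show "\<exists>U (V :: (real^3) set). openin Y U \<and> y \<in> U \<and> open V \<and> subtopology Y U homeomorphic_space top_of_set V"
    using U x by blast
qed

lemma manifold3_open_subset:
  assumes X: "manifold3 X" and W: "openin X W"
  shows "manifold3 (subtopology X W)"
  unfolding manifold3_def
proof (intro conjI ballI)
  show "Hausdorff_space (subtopology X W)" "second_countable (subtopology X W)"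
    using X by (simp_all add: manifold3_def Hausdorff_space_subtopology second_countable_subtopology)
  fix x assume "x \<in> topspace (subtopology X W)"
  then have "x \<in> W" by simp
  then obtain U and v :: "real^3" and r where U: "openin X U" "x \<in> U" "U \<subseteq> W"
    and hom: "subtopology X U homeomorphic_space top_of_set (ball v r)"
    using manifold3_ball_chart[OF X W] by metis
  have "subtopology (subtopology X W) U = subtopology X U"
    using U(3) by (simp add: subtopology_subtopology inf.absorb2)
  moreover have "openin (subtopology X W) U" using U W by (simp add: openin_open_subtopology)
  ultimately show "\<exists>U (V :: (real^3) set). openin (subtopology X W) U \<and> x \<in> U \<and> open V \<and>
      subtopology (subtopology X W) U homeomorphic_space top_of_set V"
    using U(2) hom by (metis open_ball)
qed

lemma manifold3_set_ball_chart:
  fixes T :: "'a::topological_space set"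
  assumes T: "manifold3 (top_of_set T)" and W: "openin (top_of_set T) W" and x: "x \<in> W"
  obtains U c c' and v :: "real^3" and r where "openin (top_of_set T) U" "x \<in> U" "U \<subseteq> W" "r > 0"
    "homeomorphism U (ball v r) c c'"
proof -
  obtain U and v :: "real^3" and r where U: "openin (top_of_set T) U" "x \<in> U" "U \<subseteq> W" "r > 0"
    and hom: "subtopology (top_of_set T) U homeomorphic_space top_of_set (ball v r)"
    using manifold3_ball_chart[OF T W x] by metis
  have "subtopology (top_of_set T) U = top_of_set U"
    using openin_imp_subset[OF U(1)] by (simp add: subtopology_subtopology inf.absorb2)
  then have "U homeomorphic ball v r" using hom homeomorphic_space_top_of_set by metis
  then obtain c c' where "homeomorphism U (ball v r) c c'" by (auto simp: homeomorphic_def)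
  then show thesis using that U by blast
qed

section \<open>Neighbourhoods of an end\<close>

lemma ends_component:
  assumes "e \<in> ends X" "compactin X K"
  shows "e K \<in> connected_components_of (subtopology X (topspace X - K))"
  using assms by (auto simp: ends_def PiE_iff)

lemma ends_antimono:
  assumes "e \<in> ends X" "compactin X K" "compactin X L" "K \<subseteq> L"
  shows "e L \<subseteq> e K"
  using assms by (auto simp: ends_def)

lemma ends_agree_on_smaller:
  assumes e: "e \<in> ends X" "e' \<in> ends X" and K: "compactin X K" "compactin X L" "K \<subseteq> L"
    and eq: "e' L = e L"
  shows "e' K = e K"
proof -
  have "e L \<noteq> {}"
    using ends_component[OF e(1) K(2)] nonempty_connected_components_of by blast
  moreover have "e L \<subseteq> e K \<inter> e' K"
    using ends_antimono e K eq by blast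
  ultimately have "e' K \<inter> e K \<noteq> {}" by blast
  then show ?thesis
    using connected_components_of_overlap ends_component e K(1) by metis
qed

lemma openin_end_component:
  assumes X: "Hausdorff_space X" "locally_path_connected_space X"
    and e: "e \<in> ends X" and K: "compactin X K"
  shows "openin X (e K)"
proof -
  have op: "openin X (topspace X - K)"
    using X K compactin_imp_closedin by blast
  then have "locally_connected_space (subtopology X (topspace X - K))"
    using X(2) locally_path_connected_imp_locally_connected_space locally_path_connected_space_open_subset
    by blast
  then show ?thesis
    using openin_connected_components_of_locally_connected_space[OF _ ends_component[OF e K]]
      op openin_trans_full by blast
qed

lemma openin_freudenthal_Inl_vimage:
  assumes X: "Hausdorff_space X" "locally_path_connected_space X"
    and W: "openin (freudenthal X) W"
  shows "openin X (Inl -` W)"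
proof -
  have "generate_topology_on ({Inl ` U |U. openin X U} \<union>
      {Inl ` e K \<union> Inr ` {e' \<in> ends X. e' K = e K} |e K. e \<in> ends X \<and> compactin X K}) W"
    using W unfolding freudenthal_def openin_topology_generated_by_iff .
  then show ?thesis
  proof induction
    case Empty then show ?case by simp
  next
    case (Int a b) then show ?case by (simp add: vimage_Int openin_Int)
  next
    case (UN K) then show ?case by (auto simp: vimage_Union)
  next
    case (Basis s)
    then consider U where "openin X U" "s = Inl ` U"
      | e K where "e \<in> ends X" "compactin X K" "s = Inl ` e K \<union> Inr ` {e' \<in> ends X. e' K = e K}"
      by blast
    then show ?case
    proof cases
      case 1 then show ?thesis by (simp add: inj_vimage_image_eq)
    next
      case 2
      then have "Inl -` s = e K" by auto
      then show ?thesis using openin_end_component[OF X] 2 by metis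
    qed
  qed
qed

text \<open>The subbasic neighbourhoods of an end already form a neighbourhood base: those given by two
  compact sets contain the one given by their union, since an end determines its component for
  a compact set by its component for any larger one.\<close>

lemma freudenthal_nbhd_of_end:
  assumes W: "openin (freudenthal X) W" and e: "e \<in> ends X" "Inr e \<in> W"
  obtains K where "compactin X K" "Inl ` e K \<union> Inr ` {e' \<in> ends X. e' K = e K} \<subseteq> W"
proof -
  have "generate_topology_on ({Inl ` U |U. openin X U} \<union>
      {Inl ` e K \<union> Inr ` {e' \<in> ends X. e' K = e K} |e K. e \<in> ends X \<and> compactin X K}) W"
    using W unfolding freudenthal_def openin_topology_generated_by_iff .
  then have "\<exists>K. compactin X K \<and> Inl ` e K \<union> Inr ` {e' \<in> ends X. e' K = e K} \<subseteq> W"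
    using e(2)
  proof induction
    case Empty then show ?case by simp
  next
    case (Int a b)
    then obtain K L where K: "compactin X K" "Inl ` e K \<union> Inr ` {e' \<in> ends X. e' K = e K} \<subseteq> a"
      and L: "compactin X L" "Inl ` e L \<union> Inr ` {e' \<in> ends X. e' L = e L} \<subseteq> b" by blast
    have KL: "compactin X (K \<union> L)" using K L compactin_Un by blast
    have "e (K \<union> L) \<subseteq> e K \<inter> e L" using ends_antimono[OF e(1)] KL K(1) L(1) by simp
    moreover have "e' K = e K \<and> e' L = e L" if "e' \<in> ends X" "e' (K \<union> L) = e (K \<union> L)" for e'
      using ends_agree_on_smaller[OF e(1) that(1) K(1) KL _ that(2)]
        ends_agree_on_smaller[OF e(1) that(1) L(1) KL _ that(2)] by simp
    ultimately have "Inl ` e (K \<union> L) \<union> Inr ` {e' \<in> ends X. e' (K \<union> L) = e (K \<union> L)} \<subseteq>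
        (Inl ` e K \<union> Inr ` {e' \<in> ends X. e' K = e K}) \<inter> (Inl ` e L \<union> Inr ` {e' \<in> ends X. e' L = e L})"
      by auto
    also have "\<dots> \<subseteq> a \<inter> b" by (rule Int_mono[OF K(2) L(2)])
    finally show ?case using KL by (intro exI[of _ "K \<union> L"]) simp
  next
    case (UN F)
    from UN.prems obtain k where k: "k \<in> F" "Inr e \<in> k" by (rule UnionE)
    from UN.IH[OF k] obtain K where "compactin X K" "Inl ` e K \<union> Inr ` {e' \<in> ends X. e' K = e K} \<subseteq> k"
      by (elim exE conjE)
    moreover have "k \<subseteq> \<Union>F" using k(1) by (rule Union_upper)
    ultimately show ?case by (intro exI[of _ K] conjI) (simp, rule subset_trans)
  next
    case (Basis s)
    then consider U where "s = Inl ` U"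
      | e1 K where "compactin X K" "s = Inl ` e1 K \<union> Inr ` {e' \<in> ends X. e' K = e1 K}"
      by blast
    then show ?case
    proof cases
      case 1 then show ?thesis using Basis.prems by auto
    next
      case 2
      then have "e K = e1 K" using Basis.prems by auto
      then have "Inl ` e K \<union> Inr ` {e' \<in> ends X. e' K = e K} = s" using 2(2) by simp
      then show ?thesis using 2(1) by (intro exI[of _ K] conjI) simp_all
    qed
  qed
  then show thesis using that by blast
qed

text \<open>The inclusion is open because the images of open sets are subbasic, and continuous because a
  component of the complement of a compact set is open, \<open>X\<close> being locally connected.\<close>

lemma homeomorphic_map_Inl_freudenthal:
  assumes X: "Hausdorff_space X" "locally_path_connected_space X"
  shows "homeomorphic_map X (subtopology (freudenthal X) (Inl ` topspace X)) Inl"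
proof (rule bijective_open_imp_homeomorphic_map)
  have op: "openin (freudenthal X) (Inl ` U)" if "openin X U" for U
    unfolding freudenthal_def by (rule topology_generated_by_Basis) (use that in blast)
  show "continuous_map X (subtopology (freudenthal X) (Inl ` topspace X)) Inl"
    unfolding continuous_map_in_subtopology
  proof
    show "continuous_map X (freudenthal X) Inl"
      unfolding continuous_map_def
    proof (intro conjI allI impI)
      show "Inl \<in> topspace X \<rightarrow> topspace (freudenthal X)"
        by (auto simp: topspace_freudenthal)
      fix U assume "openin (freudenthal X) U"
      then have "openin X (topspace X \<inter> Inl -` U)"
        using openin_freudenthal_Inl_vimage[OF X] by blast
      then show "openin X {x \<in> topspace X. Inl x \<in> U}"
        by (simp add: Int_def vimage_def)
    qed
  qed auto
  show "open_map X (subtopology (freudenthal X) (Inl ` topspace X)) Inl"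
    unfolding open_map_def
  proof (intro allI impI)
    fix U assume U: "openin X U"
    then have "Inl ` U \<subseteq> Inl ` topspace X" using openin_subset by blast
    then show "openin (subtopology (freudenthal X) (Inl ` topspace X)) (Inl ` U)"
      using op[OF U] openin_subset_topspace_eq openin_subtopology_Int2
      by (metis inf.absorb2)
  qed
  show "Inl ` topspace X = topspace (subtopology (freudenthal X) (Inl ` topspace X))"
    by (auto simp: topspace_freudenthal)
  show "inj_on Inl (topspace X)" by simp
qed

text \<open>The set of ends does not locally separate the compactification: what a basic neighbourhood of an end
  leaves in \<open>X\<close> is a single component of the complement of a compact set.\<close>

lemma freudenthal_end_connected_nbhd:
  assumes X: "Hausdorff_space X" "locally_path_connected_space X"
    and W: "openin (freudenthal X) W" and c: "c \<in> W" "c \<notin> Inl ` topspace X"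
  obtains V where "openin (freudenthal X) V" "c \<in> V" "V \<subseteq> W"
    "connectedin (freudenthal X) (V \<inter> Inl ` topspace X)" "V \<inter> Inl ` topspace X \<noteq> {}"
proof -
  have "c \<in> topspace (freudenthal X)" using W c openin_subset by blast
  then obtain e where e: "e \<in> ends X" "c = Inr e" using c(2) by (auto simp: topspace_freudenthal)
  obtain K where K: "compactin X K" "Inl ` e K \<union> Inr ` {e' \<in> ends X. e' K = e K} \<subseteq> W"
    by (rule freudenthal_nbhd_of_end[OF W e(1)]) (use e(2) c(1) in simp_all)
  let ?V = "Inl ` e K \<union> Inr ` {e' \<in> ends X. e' K = e K}"
  have comp: "e K \<in> connected_components_of (subtopology X (topspace X - K))"
    by (rule ends_component[OF e(1) K(1)])
  then have con: "connectedin X (e K)"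
    using connectedin_connected_components_of connectedin_subtopology by blast
  then have sub: "e K \<subseteq> topspace X" by (rule connectedin_subset_topspace)
  have eq: "?V \<inter> Inl ` topspace X = Inl ` e K" using sub by auto
  have "continuous_map X (freudenthal X) Inl"
    using homeomorphic_map_Inl_freudenthal[OF X] homeomorphic_imp_continuous_map continuous_map_in_subtopology
    by blast
  then have "connectedin (freudenthal X) (Inl ` e K)"
    using con connectedin_continuous_map_image by blast
  moreover have "openin (freudenthal X) ?V"
    unfolding freudenthal_def by (rule topology_generated_by_Basis) (use e K in blast)
  moreover have "e K \<noteq> {}" using comp nonempty_connected_components_of by blast
  ultimately show thesis using that[of ?V] K e(2) eq e(1) by auto
qed

section \<open>Extending homeomorphisms of complements\<close>

text \<open>A condition saying that removing \<open>E\<close> does not disconnect \<open>S\<close> near \<open>x\<close>, and that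
  \<open>x\<close> can be approached from outside \<open>E\<close>. If \<open>S\<close> is compact and \<open>E\<close> closed and totally
  disconnected, it makes \<open>x \<in> E\<close> the limit of exactly one end of \<open>S - E\<close>.\<close>

definition connected_off_at :: "'a::topological_space set \<Rightarrow> 'a set \<Rightarrow> 'a \<Rightarrow> bool" where
  "connected_off_at S E x \<longleftrightarrow> (\<forall>U. open U \<longrightarrow> x \<in> U \<longrightarrow>
     (\<exists>W. open W \<and> x \<in> W \<and> W \<subseteq> U \<and> connected (S \<inter> W - E) \<and> S \<inter> W - E \<noteq> {}))"

definition connected_off :: "'a::topological_space set \<Rightarrow> 'a set \<Rightarrow> bool" where
  "connected_off S E \<longleftrightarrow> (\<forall>x\<in>S. connected_off_at S E x)"

lemma connected_off_dense:
  assumes "connected_off S E" shows "S \<subseteq> closure (S - E)"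
proof
  fix x assume "x \<in> S"
  show "x \<in> closure (S - E)"
    unfolding closure_iff_nhds_not_empty
  proof (intro allI impI)
    fix A V assume "V \<subseteq> A" "open V" "x \<in> V"
    then obtain W where "W \<subseteq> V" "S \<inter> W - E \<noteq> {}"
      using assms \<open>x \<in> S\<close> unfolding connected_off_def connected_off_at_def by meson
    then show "(S - E) \<inter> A \<noteq> {}" using \<open>V \<subseteq> A\<close> by blast
  qed
qed

definition totally_disconnected :: "'a::topological_space set \<Rightarrow> bool" where
  "totally_disconnected F \<longleftrightarrow> (\<forall>Q. Q \<subseteq> F \<longrightarrow> connected Q \<longrightarrow> (\<exists>y. Q \<subseteq> {y}))"

text \<open>The cluster set of \<open>f\<close> at \<open>x\<close> is a nested intersection of closures of images of connected sets,
  hence compact, connected and nonempty. It lies in \<open>F\<close>, because a value of \<open>f\<close> cannot be approached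
  along points that tend to \<open>x\<close>. As \<open>F\<close> is totally disconnected, it is a single point.\<close>

lemma homeomorphism_converges_at_removed_point:
  fixes S S' :: "'a::euclidean_space set"
  assumes off: "connected_off S E"
    and S': "compact S'" and F: "totally_disconnected F"
    and hom: "homeomorphism (S - E) (S' - F) f g" and x: "x \<in> S" "x \<in> E"
  obtains y where "y \<in> S'" "(f \<longlongrightarrow> y) (at x within (S - E))"
proof -
  have "\<exists>W. (open W \<and> x \<in> W \<and> W \<subseteq> U \<and> connected (S \<inter> W - E) \<and> S \<inter> W - E \<noteq> {})"
    if "open U" "x \<in> U" for U
    using off x(1) that unfolding connected_off_def connected_off_at_def by meson
  then obtain \<Phi> where \<Phi>: "\<And>U. open U \<Longrightarrow> x \<in> U \<Longrightarrow> open (\<Phi> U) \<and> x \<in> \<Phi> U \<and> \<Phi> U \<subseteq> U \<and>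
      connected (S \<inter> \<Phi> U - E) \<and> S \<inter> \<Phi> U - E \<noteq> {}" by metis
  define W where "W = rec_nat (\<Phi> UNIV) (\<lambda>n V. \<Phi> (V \<inter> ball x (1 / Suc n)))"
  have W0: "W 0 = \<Phi> UNIV" and WS: "W (Suc n) = \<Phi> (W n \<inter> ball x (1 / Suc n))" for n
    by (simp_all add: W_def)
  have Wop: "open (W n) \<and> x \<in> W n" for n
    by (induction n) (use \<Phi> in \<open>auto simp: W0 WS open_Int\<close>)
  have Wsub: "W (Suc n) \<subseteq> W n \<inter> ball x (1 / Suc n)" for n
    using \<Phi>[of "W n \<inter> ball x (1 / Suc n)"] Wop[of n] by (auto simp: WS open_Int)
  have Wcon: "connected (S \<inter> W n - E) \<and> S \<inter> W n - E \<noteq> {}" for n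
  proof (cases n)
    case 0 then show ?thesis using \<Phi>[of UNIV] by (simp add: W0)
  next
    case (Suc m) then show ?thesis using \<Phi>[of "W m \<inter> ball x (1 / Suc m)"] Wop[of m] by (simp add: WS open_Int)
  qed
  have Wmono: "W n \<subseteq> W m" if "m \<le> n" for m n
    using that by (rule lift_Suc_antimono_le[rotated]) (use Wsub in blast)
  define Z where "Z n = closure (f ` (S \<inter> W n - E))" for n
  have fS: "f ` (S - E) = S' - F" and cf: "continuous_on (S - E) f"
    and gf: "\<And>z. z \<in> S - E \<Longrightarrow> g (f z) = z" and cg: "continuous_on (S' - F) g"
    using hom by (auto simp: homeomorphism_def)
  have ZS': "Z n \<subseteq> S'" for n
    unfolding Z_def by (rule closure_minimal) (use fS compact_imp_closed[OF S'] in auto)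
  have Zc: "compact (Z n)" for n
    using ZS'[of n] S' by (metis Z_def closed_closure compact_Int_closed inf.absorb2)
  have Zcon: "connected (Z n)" for n
    unfolding Z_def by (intro connected_imp_connected_closure connected_continuous_image continuous_on_subset[OF cf])
      (use Wcon in auto)
  have Zne: "Z n \<noteq> {}" for n
    unfolding Z_def using Wcon by simp
  have Zmono: "Z n \<subseteq> Z m" if "m \<le> n" for m n
    unfolding Z_def by (intro closure_mono image_mono) (use Wmono[OF that] in blast)
  have ne: "\<Inter>(range Z) \<noteq> {}" and con: "connected (\<Inter>(range Z))"
    using compact_nest[of Z] connected_nest[of Z] Zc Zcon Zne Zmono by blast+
  have "\<Inter>(range Z) \<subseteq> F"
  proof (rule ccontr)
    \<comment> \<open>a limit point outside F would be attained by f, at a point other than x\<close>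
    assume "\<not> \<Inter>(range Z) \<subseteq> F"
    then obtain y where y: "\<And>n. y \<in> Z n" "y \<in> S' - F" using ZS' by blast
    have gy: "g y \<in> S - E" using hom y(2) by (auto simp: homeomorphism_def)
    then have "g y \<noteq> x" using x by blast
    then have d: "dist (g y) x / 2 > 0" by simp
    have "continuous (at y within (S' - F)) g" using cg y(2) continuous_on_eq_continuous_within by blast
    then obtain \<delta> where \<delta>: "\<delta> > 0" "\<And>z. z \<in> S' - F \<Longrightarrow> dist z y < \<delta> \<Longrightarrow> dist (g z) (g y) < dist (g y) x / 2"
      using d unfolding continuous_within_eps_delta by blast
    obtain n where n: "1 / Suc n < dist (g y) x / 2" using d nat_approx_posE by blast
    from y(1)[of "Suc n"] obtain u where u: "u \<in> S \<inter> W (Suc n) - E" "dist (f u) y < \<delta>"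
      unfolding Z_def closure_approachable using \<delta>(1) by blast
    have "dist u (g y) < dist (g y) x / 2"
      using \<delta>(2)[OF _ u(2)] gf u(1) fS by fastforce
    moreover have "dist x u < dist (g y) x / 2"
      using Wsub[of n] u(1) n by fastforce
    ultimately show False using dist_triangle[of "g y" x u] by (simp add: dist_commute)
  qed
  with con F ne obtain y where y: "\<Inter>(range Z) = {y}"
    unfolding totally_disconnected_def by (metis subset_singleton_iff)
  have "(f \<longlongrightarrow> y) (at x within (S - E))"
  proof (rule topological_tendstoI)
    fix T assume T: "open T" "y \<in> T"
    have "\<exists>n. Z n \<subseteq> T"
    proof (rule ccontr)
      assume no: "\<nexists>n. Z n \<subseteq> T"
      have "\<Inter>(range (\<lambda>n. Z n - T)) \<noteq> {}"
      proof (rule compact_nest)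
        show "compact (Z n - T)" for n using Zc T(1) by (rule compact_diff)
        show "Z n - T \<noteq> {}" for n using no by blast
        show "Z n - T \<subseteq> Z m - T" if "m \<le> n" for m n using Zmono[OF that] by blast
      qed
      then show False using y T by blast
    qed
    then obtain n where "Z n \<subseteq> T" by blast
    then have "f u \<in> T" if "u \<in> W n" "u \<in> S - E" for u
      using that closure_subset[of "f ` (S \<inter> W n - E)"] unfolding Z_def by blast
    then show "eventually (\<lambda>u. f u \<in> T) (at x within (S - E))"
      unfolding eventually_at_topological using Wop by blast
  qed
  moreover have "y \<in> S'" using y ZS' by blast
  ultimately show thesis using that by blast
qed

lemma atin_within_euclidean: "atin_within euclidean a S = at a within S"
proof (rule filter_eqI)
  fix P
  have "(\<forall>x\<in>T. x \<in> S \<and> x \<noteq> a \<longrightarrow> P x) \<longleftrightarrow> (\<forall>x\<in>T. x \<noteq> a \<longrightarrow> x \<in> S \<longrightarrow> P x)" for T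
    by blast
  then show "eventually P (atin_within euclidean a S) \<longleftrightarrow> eventually P (at a within S)"
    by (simp add: eventually_atin_within eventually_at_topological)
qed

lemma homeomorphism_extends_continuously:
  fixes S S' :: "'a::euclidean_space set"
  assumes off: "connected_off S E"
    and S': "compact S'" and F: "totally_disconnected F"
    and hom: "homeomorphism (S - E) (S' - F) f g"
  obtains h where "continuous_on S h" "h ` S \<subseteq> S'" "\<And>x. x \<in> S - E \<Longrightarrow> h x = f x"
proof -
  have fS: "f ` (S - E) = S' - F" and cf: "continuous_on (S - E) f"
    using hom by (auto simp: homeomorphism_def)
  obtain h where h: "continuous_map (subtopology euclidean S) (top_of_set S') h"
    and hf: "\<And>x. x \<in> S - E \<Longrightarrow> h x = f x"
  proof (rule continuous_map_extension_pointwise_alt[of "top_of_set S'" "S - E" S euclidean f])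
    show "regular_space (top_of_set S')"
      by (simp add: compact_Hausdorff_imp_regular_space S' compact_space_subtopology Hausdorff_space_subtopology compactin_subtopology)
    show "S - E \<subseteq> S" by blast
    show "S \<subseteq> euclidean closure_of (S - E)" using connected_off_dense[OF off] by simp
    show "continuous_map (top_of_set (S - E)) (top_of_set S') f" using cf fS by auto
    fix t assume "t \<in> S - (S - E)"
    then obtain y where y: "y \<in> S'" "(f \<longlongrightarrow> y) (at t within (S - E))"
      using homeomorphism_converges_at_removed_point[OF off S' F hom] by blast
    have "limitin (top_of_set S') f y (atin_within euclidean t (S - E))"
      unfolding limitin_subtopology
    proof (intro conjI)
      show "limitin euclidean f y (atin_within euclidean t (S - E))"
        using y(2) by (simp add: limitin_canonical_iff atin_within_euclidean)
      show "\<forall>\<^sub>F a in atin_within euclidean t (S - E). f a \<in> S'"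
        using fS by (auto simp: eventually_atin_within intro!: exI[of _ UNIV])
    qed (use y in auto)
    then show "\<exists>l. limitin (top_of_set S') f l (atin_within euclidean t (S - E))" by blast
  qed blast
  then show thesis using that by auto
qed

text \<open>Both the homeomorphism and its inverse extend continuously; the extensions are inverse to each other
  on dense subsets, hence everywhere. In effect, \<open>S\<close> and \<open>S'\<close> are the end compactifications of
  the two complements, and a homeomorphism acts on these.\<close>

theorem homeomorphism_of_complements_extends:
  fixes S S' :: "'a::euclidean_space set"
  assumes S: "compact S" "connected_off S E" "totally_disconnected E" "E \<subseteq> S"
    and S': "compact S'" "connected_off S' F" "totally_disconnected F" "F \<subseteq> S'"
    and hom: "(S - E) homeomorphic (S' - F)"
  obtains h k where "homeomorphism S S' h k" "h ` E = F"
proof -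
  obtain f g where fg: "homeomorphism (S - E) (S' - F) f g"
    using hom homeomorphic_def by blast
  then have gf: "homeomorphism (S' - F) (S - E) g f" by (rule homeomorphism_symD)
  obtain h where h: "continuous_on S h" "h ` S \<subseteq> S'" "\<And>x. x \<in> S - E \<Longrightarrow> h x = f x"
    using homeomorphism_extends_continuously[OF S(2) S'(1,3) fg] by blast
  obtain k where k: "continuous_on S' k" "k ` S' \<subseteq> S" "\<And>x. x \<in> S' - F \<Longrightarrow> k x = g x"
    using homeomorphism_extends_continuously[OF S'(2) S(1,3) gf] by blast
  have fS: "f x \<in> S' - F" "g (f x) = x" if "x \<in> S - E" for x
    using fg that by (auto simp: homeomorphism_def)
  have gS: "g x \<in> S - E" "f (g x) = x" if "x \<in> S' - F" for x
    using fg that by (auto simp: homeomorphism_def)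
  have id_ext: "j x = x" if "continuous_on A j" "A \<subseteq> closure (A - D)" "\<And>x. x \<in> A - D \<Longrightarrow> j x = x" "x \<in> A"
    for A D :: "'a set" and j x
  proof -
    have "closedin (top_of_set A) {x \<in> A. j x = x}"
      using continuous_closedin_preimage_constant[of A "\<lambda>x. j x - x" 0] that(1)
      by (simp add: continuous_on_diff)
    then obtain T where T: "closed T" "{x \<in> A. j x = x} = A \<inter> T" unfolding closedin_closed by blast
    then have "closure (A - D) \<subseteq> T" using that(3) by (intro closure_minimal) blast
    then show ?thesis using T that by blast
  qed
  have kh: "k (h x) = x" if "x \<in> S" for x
    by (rule id_ext[OF continuous_on_compose2[OF k(1) h(1,2)] connected_off_dense[OF S(2)] _ that])
      (use h k fS in simp)
  have hk: "h (k x) = x" if "x \<in> S'" for x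
    by (rule id_ext[OF continuous_on_compose2[OF h(1) k(1,2)] connected_off_dense[OF S'(2)] _ that])
      (use h k gS in simp)
  have "homeomorphism S S' h k"
    by (rule homeomorphismI) (use h k hk kh in auto)
  moreover have "h ` E = F"
  proof
    show "h ` E \<subseteq> F"
    proof clarify
      fix x assume x: "x \<in> E"
      then have "x \<in> S" using S by blast
      show "h x \<in> F"
      proof (rule ccontr)
        assume "h x \<notin> F"
        then have "h x \<in> S' - F" using h(2) \<open>x \<in> S\<close> by blast
        then have "k (h x) \<in> S - E" using k(3) gS by simp
        then show False using kh \<open>x \<in> S\<close> x by simp
      qed
    qed
    show "F \<subseteq> h ` E"
    proof
      fix y assume y: "y \<in> F"
      then have yS: "y \<in> S'" using S' by blast
      have "k y \<in> E"
      proof (rule ccontr)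
        assume "k y \<notin> E"
        then have "k y \<in> S - E" using k(2) yS by blast
        then have "h (k y) \<in> S' - F" using h(3) fS by simp
        then show False using hk yS y by simp
      qed
      then show "y \<in> h ` E" using hk[OF yS] by (metis image_eqI)
    qed
  qed
  ultimately show thesis using that by blast
qed

section \<open>Pushing maps off a countable compact set\<close>

text \<open>General position. In the chart, \<open>f\<close> is approximated by a polynomial map \<open>g\<close>, whose image is null because the
  dimension of its domain is smaller. The translations of \<open>g\<close> that hit the countable set \<open>A\<close>
  therefore form a null set, so that an arbitrarily small translation makes \<open>g\<close> miss \<open>A\<close>. A cutoff
  function of the distance to \<open>A\<close> interpolates between this map near \<open>A\<close> and \<open>f\<close> away from \<open>A\<close>; where
  the cutoff is not 1, the moved points stay closer to \<open>f\<close> than \<open>f\<close> is to \<open>A\<close>.\<close>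

lemma push_off_countable_set_in_chart:
  fixes f :: "'p::euclidean_space \<Rightarrow> 'a::euclidean_space" and c :: "'a \<Rightarrow> 'n::euclidean_space"
  assumes dim: "DIM('p) < DIM('n)"
    and D: "compact D" and f: "continuous_on D f" "f ` D \<subseteq> T"
    and U: "openin (top_of_set T) U" and V: "open V" and c: "homeomorphism U V c c'"
    and A: "A \<subseteq> U" "compact A" "countable A"
  shows "\<exists>h :: real \<times> 'p \<Rightarrow> 'a. continuous_on ({0..1} \<times> D) h \<and> h \<in> {0..1} \<times> D \<rightarrow> T \<and>
    (\<forall>x\<in>D. h (0, x) = f x) \<and> (\<forall>x\<in>D. h (1, x) \<notin> A) \<and>
    (\<forall>x\<in>D. f x \<notin> U \<longrightarrow> (\<forall>t. h (t, x) = f x))"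
proof (cases "A = {}")
  case True
  show ?thesis
  proof (intro exI[of _ "f \<circ> snd"] conjI)
    show "continuous_on ({0..1} \<times> D) (f \<circ> snd)"
      by (intro continuous_on_compose continuous_on_subset[OF f(1)] continuous_intros) auto
  qed (use f True in auto)
next
  case False
  have cU: "c ` U = V" and c'V: "c' ` V = U" and c'c: "\<And>x. x \<in> U \<Longrightarrow> c' (c x) = x"
    and cc': "\<And>z. z \<in> V \<Longrightarrow> c (c' z) = z" and cont_c: "continuous_on U c" and cont_c': "continuous_on V c'"
    using c by (auto simp: homeomorphism_def)
  define A' where "A' = c ` A"
  have A': "compact A'" "countable A'" "A' \<noteq> {}" "A' \<subseteq> V"
    unfolding A'_def using A False cU continuous_on_subset[OF cont_c A(1)]
    by (auto intro: compact_continuous_image)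
  obtain e0 where e0: "e0 > 0" "{z. infdist z A' \<le> e0} \<subseteq> V"
    using compact_in_open_separated[OF A'(3,1) V A'(4)] by blast
  \<comment> \<open>points at distance at most e from A' are moved by less than e/2, so twice e keeps them in V\<close>
  define e where "e = e0 / 2"
  have e: "e > 0" "{z. infdist z A' \<le> 2 * e} \<subseteq> V"
    using e0 by (simp_all add: e_def)
  define N where "N = {z. infdist z A' \<le> e}"
  define N0 where "N0 = {z. infdist z A' < e}"
  have NV: "N \<subseteq> V" and N0V: "N0 \<subseteq> V"
    using e by (force simp: N_def N0_def)+
  have A'N: "A' \<subseteq> N" using e by (auto simp: N_def)
  have "compact N"
    unfolding N_def using compact_infdist_le[OF A'(3,1) e(1)] .
  then have "compact (c' ` N)"
    using continuous_on_subset[OF cont_c' NV] by (rule compact_continuous_image[rotated])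
  define Q where "Q = {x \<in> D. f x \<in> c' ` N}"
  define R where "R = {x \<in> D. f x \<notin> c' ` N0}"
  have "closedin (top_of_set D) (D \<inter> f -` (c' ` N))"
    using continuous_closedin_preimage[OF f(1) compact_imp_closed[OF \<open>compact (c' ` N)\<close>]] .
  also have "D \<inter> f -` (c' ` N) = Q" by (auto simp: Q_def)
  finally have Qc: "compact Q" using D closedin_compact by blast
  have "open N0"
    unfolding N0_def by (intro open_Collect_less continuous_intros)
  then have "openin (top_of_set V) N0" using N0V V by (simp add: openin_open_eq)
  then have "openin (top_of_set U) (c' ` N0)"
    using homeomorphism_imp_open_map[OF homeomorphism_symD[OF c]] by blast
  then have "openin (top_of_set T) (c' ` N0)" using U by (rule openin_trans)
  then have "openin (top_of_set D) (D \<inter> f -` (c' ` N0))"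
    using continuous_openin_preimage f by (metis image_subset_iff_funcset)
  then have "closedin (top_of_set D) (D - D \<inter> f -` (c' ` N0))"
    by (intro closedin_diff) auto
  also have "D - D \<inter> f -` (c' ` N0) = R" by (auto simp: R_def)
  finally have Rc: "compact R" using D closedin_compact by blast
  have "N0 \<subseteq> N" by (auto simp: N_def N0_def)
  then have QR: "D = Q \<union> R" by (auto simp: Q_def R_def)
  have QD: "Q \<subseteq> D" and RD: "R \<subseteq> D" by (auto simp: Q_def R_def)
  define F where "F = c \<circ> f"
  have fQ: "f x \<in> U" "F x \<in> N" "c' (F x) = f x" if "x \<in> Q" for x
    using that NV c'V cc' by (auto simp: Q_def F_def)
  have contF: "continuous_on Q F"
    unfolding F_def by (intro continuous_on_compose continuous_on_subset[OF f(1) QD] continuous_on_subset[OF cont_c])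
      (use fQ in auto)
  obtain g where g: "polynomial_function g" "\<And>x. x \<in> Q \<Longrightarrow> norm (F x - g x) < e / 4"
    using Stone_Weierstrass_polynomial_function[OF Qc contF, of "e/4"] e by auto
  \<comment> \<open>the translations that carry a point of the image of g into A': a countable union of null sets\<close>
  have "negligible (\<Union>a\<in>A'. (\<lambda>x. a - g x) ` Q)"
  proof (rule negligible_countable_Union)
    show "countable ((\<lambda>a. (\<lambda>x. a - g x) ` Q) ` A')" using A' by simp
    fix S assume "S \<in> (\<lambda>a. (\<lambda>x. a - g x) ` Q) ` A'"
    then obtain a where S: "S = (\<lambda>x. a - g x) ` Q" by blast
    have "(\<lambda>x. a - g x) differentiable_on Q"
      by (intro differentiable_on_diff differentiable_on_const differentiable_on_polynomial_function g)
    then show "negligible S"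
      unfolding S by (rule negligible_differentiable_image_lowdim[OF dim])
  qed
  moreover have "\<not> negligible (ball (0::'n) (e/4))"
    using e by (simp add: open_not_negligible)
  ultimately obtain v where v: "norm v < e / 4" "v \<notin> (\<Union>a\<in>A'. (\<lambda>x. a - g x) ` Q)"
    by (metis negligible_subset subsetI mem_ball_0)
  define P where "P x = g x + v" for x
  have P: "norm (P x - F x) < e / 2" "P x \<notin> A'" if "x \<in> Q" for x
  proof -
    have "P x - F x = v - (F x - g x)" by (simp add: P_def)
    then have "norm (P x - F x) \<le> norm v + norm (F x - g x)"
      by (metis norm_triangle_ineq4)
    then show "norm (P x - F x) < e / 2"
      using v(1) g(2)[OF that] by linarith
    show "P x \<notin> A'"
    proof
      assume "P x \<in> A'"
      moreover have "v \<in> (\<lambda>y. P x - g y) ` Q"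
        using that by (intro image_eqI[of _ _ x]) (simp_all add: P_def)
      ultimately show False using v(2) by (meson UN_I)
    qed
  qed
  \<comment> \<open>the cutoff: 1 within e/2 of A', 0 from distance e on, so that h is continuous across the edge of Q\<close>
  define l where "l x = max 0 (min 1 (2 - 2 * infdist (F x) A' / e))" for x
  have l: "0 \<le> l x" "l x \<le> 1" for x by (auto simp: l_def)
  have l0: "l x = 0" if "infdist (F x) A' = e" for x using that e(1) by (simp add: l_def)
  have l1: "l x = 1" if "infdist (F x) A' \<le> e / 2" for x
    using that e(1) by (simp add: l_def field_simps)
  define G where "G t x = F x + (t * l x) *\<^sub>R (P x - F x)" for t x
  have GF: "norm (G t x - F x) < e / 2" if "x \<in> Q" "t \<in> {0..1}" for t x
  proof -
    have "norm (G t x - F x) = (t * l x) * norm (P x - F x)"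
      using that l[of x] by (simp add: G_def)
    also have "\<dots> \<le> 1 * norm (P x - F x)"
      using that l[of x] by (intro mult_right_mono mult_le_one) auto
    also have "\<dots> < e / 2" using P that by simp
    finally show ?thesis .
  qed
  have GV: "G t x \<in> V" if "x \<in> Q" "t \<in> {0..1}" for t x
  proof -
    have "infdist (G t x) A' \<le> infdist (F x) A' + dist (G t x) (F x)"
      by (rule infdist_triangle)
    also have "\<dots> \<le> e + e" using fQ(2)[OF that(1)] GF[OF that] e(1) by (simp add: N_def dist_norm)
    finally show ?thesis using e(2) by auto
  qed
  have G1: "G 1 x \<notin> A'" if "x \<in> Q" for x
  proof (cases "infdist (F x) A' \<le> e / 2")
    case True
    then show ?thesis using P(2)[OF that] by (simp add: G_def l1)
  next
    case False
    show ?thesis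
    proof
      assume "G 1 x \<in> A'"
      then have "infdist (F x) A' \<le> dist (F x) (G 1 x)" by (rule infdist_le)
      also have "\<dots> < e / 2" using GF[OF that, of 1] by (simp add: dist_norm norm_minus_commute)
      finally show False using False by simp
    qed
  qed
  define h where "h y = (if snd y \<in> Q then c' (G (fst y) (snd y)) else f (snd y))" for y :: "real \<times> 'p"
  have contG: "continuous_on ({0..1} \<times> Q) (\<lambda>y. G (fst y) (snd y))"
  proof -
    have cF: "continuous_on ({0..1} \<times> Q) (\<lambda>y. F (snd y))"
      by (intro continuous_on_compose2[OF contF] continuous_intros) auto
    have cP: "continuous_on ({0..1} \<times> Q) (\<lambda>y. P (snd y))"
      unfolding P_def
      by (intro continuous_intros continuous_on_compose2[OF continuous_on_polymonial_function[OF g(1)]]) auto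
    show ?thesis
      unfolding G_def l_def using e(1)
      by (intro continuous_intros cF cP) auto
  qed
  have "continuous_on ({0..1} \<times> Q \<union> {0..1} \<times> R) h"
    unfolding h_def
  proof (rule continuous_on_cases)
    show "closed ({0..1::real} \<times> Q)" "closed ({0..1::real} \<times> R)"
      using Qc Rc by (auto intro: closed_Times compact_imp_closed)
    show "continuous_on ({0..1} \<times> Q) (\<lambda>y. c' (G (fst y) (snd y)))"
      by (rule continuous_on_compose2[OF cont_c' contG]) (use GV in auto)
    show "continuous_on ({0..1} \<times> R) (\<lambda>y. f (snd y))"
      by (rule continuous_on_compose2[OF continuous_on_subset[OF f(1) RD]]) (auto intro: continuous_intros)
    have "G t x = F x" if "x \<in> Q" "x \<in> R" for t x
    proof -
      have "infdist (F x) A' = e"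
      proof (rule ccontr)
        assume "infdist (F x) A' \<noteq> e"
        then have "F x \<in> N0" using fQ(2)[OF that(1)] by (auto simp: N_def N0_def)
        then show False using fQ(3)[OF that(1)] that(2) by (force simp: R_def)
      qed
      then show ?thesis by (simp add: G_def l0)
    qed
    then show "\<forall>y. y \<in> {0..1} \<times> Q \<and> \<not> snd y \<in> Q \<or> y \<in> {0..1} \<times> R \<and> snd y \<in> Q \<longrightarrow>
        c' (G (fst y) (snd y)) = f (snd y)"
      using fQ(3) by auto
  qed
  moreover have "{0..1} \<times> Q \<union> {0..1::real} \<times> R = {0..1} \<times> D" using QR by blast
  ultimately have conth: "continuous_on ({0..1} \<times> D) h" by simp
  have UT: "U \<subseteq> T" using U openin_imp_subset by blast
  show ?thesis
  proof (intro exI[of _ h] conjI ballI allI impI conth)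
    show "h \<in> {0..1} \<times> D \<rightarrow> T"
      using GV c'V UT f(2) by (force simp: h_def)
    show "h (0, x) = f x" if "x \<in> D" for x
      using fQ(3) by (simp add: h_def G_def)
    show "h (1, x) \<notin> A" if x: "x \<in> D" for x
    proof (cases "x \<in> Q")
      case True
      have "c (h (1, x)) = G 1 x" using True GV[OF True, of 1] cc' by (simp add: h_def)
      then show ?thesis using G1[OF True] unfolding A'_def by (metis imageI)
    next
      case False
      have "A \<subseteq> c' ` N"
      proof
        fix a assume a: "a \<in> A"
        have "a = c' (c a)" using a A(1) c'c by auto
        moreover have "c a \<in> N" using a A'N by (auto simp: A'_def)
        ultimately show "a \<in> c' ` N" by (rule image_eqI)
      qed
      then show ?thesis using False x by (auto simp: h_def Q_def)
    qed
    show "h (t, x) = f x" if "x \<in> D" "f x \<notin> U" for t x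
      using that fQ(1) by (auto simp: h_def)
  qed
qed

text \<open>The homotopy can be kept constant on \<open>B\<close> by removing the compact set \<open>f ` B\<close> from the chart, since
  points outside the chart do not move.\<close>

lemma push_off_countable_set:
  fixes f :: "'p::euclidean_space \<Rightarrow> 'a::euclidean_space" and c :: "'a \<Rightarrow> 'n::euclidean_space"
  assumes dim: "DIM('p) < DIM('n)"
    and D: "compact D" and f: "continuous_on D f" "f ` D \<subseteq> T" and B: "compact B" "B \<subseteq> D" "f ` B \<inter> A = {}"
    and U: "openin (top_of_set T) U" and V: "open V" and c: "homeomorphism U V c c'"
    and A: "A \<subseteq> U" "compact A" "countable A"
  shows "\<exists>h :: real \<times> 'p \<Rightarrow> 'a. continuous_on ({0..1} \<times> D) h \<and> h \<in> {0..1} \<times> D \<rightarrow> T \<and>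
    (\<forall>x\<in>D. h (0, x) = f x) \<and> (\<forall>x\<in>D. h (1, x) \<notin> A) \<and> (\<forall>x\<in>B. \<forall>t. h (t, x) = f x)"
proof -
  have fB: "closed (f ` B)"
    by (intro compact_imp_closed compact_continuous_image continuous_on_subset[OF f(1) B(2)] B(1))
  let ?U = "U - f ` B"
  have U': "openin (top_of_set U) ?U"
    using fB by (simp add: Diff_eq openin_open_Int open_Compl)
  then have "openin (top_of_set V) (c ` ?U)"
    using homeomorphism_imp_open_map[OF c] by blast
  then have V': "open (c ` ?U)" using V openin_open_eq by blast
  have hom: "homeomorphism ?U (c ` ?U) c c'"
    by (rule homeomorphism_of_subsets[OF c]) auto
  have AU: "A \<subseteq> ?U" using A(1) B(3) by blast
  obtain h :: "real \<times> 'p \<Rightarrow> 'a" where h: "continuous_on ({0..1} \<times> D) h" "h \<in> {0..1} \<times> D \<rightarrow> T"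
    "\<forall>x\<in>D. h (0, x) = f x" "\<forall>x\<in>D. h (1, x) \<notin> A"
    "\<forall>x\<in>D. f x \<notin> ?U \<longrightarrow> (\<forall>t. h (t, x) = f x)"
    using push_off_countable_set_in_chart[OF dim D f openin_trans[OF U' U] V' hom AU A(2,3)]
    by (elim exE conjE)
  then have "\<forall>x\<in>B. \<forall>t. h (t, x) = f x" using B(2) by auto
  with h(1-4) show ?thesis by blast
qed

section \<open>Computing with the fundamental group\<close>

lemma equiv_loop_homotopy: "equiv (loops X x) (loop_homotopy X x)"
proof (rule equivI)
  show "loop_homotopy X x \<subseteq> loops X x \<times> loops X x"
    by (auto simp: loop_homotopy_def)
  show "refl_on (loops X x) (loop_homotopy X x)"
    by (auto simp: refl_on_def loop_homotopy_def loops_def pathin_def)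
  show "sym (loop_homotopy X x)"
    unfolding sym_def loop_homotopy_def by (auto intro: homotopic_with_symD)
  show "trans (loop_homotopy X x)"
    unfolding trans_def loop_homotopy_def by (auto intro: homotopic_with_trans)
qed

text \<open>The facts needed to compute in the fundamental group with representatives. They hold for
  subsets of normed spaces and are carried over to other spaces by homeomorphisms.\<close>

definition loop_calculus :: "'a topology \<Rightarrow> 'a \<Rightarrow> bool" where
  "loop_calculus X x \<longleftrightarrow> equiv (loops X x) (loop_homotopy X x) \<and>
     (\<forall>p\<in>loops X x. \<forall>q\<in>loops X x. loop_join p q \<in> loops X x) \<and>
     (\<forall>p p' q q'. (p, p') \<in> loop_homotopy X x \<longrightarrow> (q, q') \<in> loop_homotopy X x \<longrightarrow>
        (loop_join p q, loop_join p' q') \<in> loop_homotopy X x)"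

lemma fundamental_group_mult_class:
  assumes "loop_calculus X x" "p \<in> loops X x" "q \<in> loops X x"
  shows "loop_homotopy X x `` {p} \<otimes>\<^bsub>fundamental_group X x\<^esub> loop_homotopy X x `` {q} =
    loop_homotopy X x `` {loop_join p q}"
proof -
  let ?h = "loop_homotopy X x"
  have eq: "equiv (loops X x) ?h" using assms(1) by (simp add: loop_calculus_def)
  have "?h `` {loop_join p' q'} = ?h `` {loop_join p q}" if "p' \<in> ?h `` {p}" "q' \<in> ?h `` {q}" for p' q'
  proof -
    have "(loop_join p q, loop_join p' q') \<in> ?h"
      using assms(1) that unfolding loop_calculus_def by blast
    then show ?thesis using equiv_class_eq[OF eq] by metis
  qed
  moreover have "p \<in> ?h `` {p}" "q \<in> ?h `` {q}"
    using equiv_class_self[OF eq] assms by auto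
  ultimately have "(\<Union>p'\<in>?h `` {p}. \<Union>q'\<in>?h `` {q}. ?h `` {loop_join p' q'}) = ?h `` {loop_join p q}"
    by blast
  then show ?thesis by (simp add: fundamental_group_def)
qed

text \<open>A map of loops need only respect joins up to homotopy, and be injective and surjective up to
  homotopy, to induce an isomorphism.\<close>

lemma fundamental_group_isoI:
  assumes X: "loop_calculus X x" and Y: "loop_calculus Y y"
    and \<phi>: "\<And>p. p \<in> loops X x \<Longrightarrow> \<phi> p \<in> loops Y y"
    and hom: "\<And>p q. p \<in> loops X x \<Longrightarrow> q \<in> loops X x \<Longrightarrow>
       (p, q) \<in> loop_homotopy X x \<longleftrightarrow> (\<phi> p, \<phi> q) \<in> loop_homotopy Y y"
    and join: "\<And>p q. p \<in> loops X x \<Longrightarrow> q \<in> loops X x \<Longrightarrow>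
       (\<phi> (loop_join p q), loop_join (\<phi> p) (\<phi> q)) \<in> loop_homotopy Y y"
    and surj: "\<And>q. q \<in> loops Y y \<Longrightarrow> \<exists>p\<in>loops X x. (\<phi> p, q) \<in> loop_homotopy Y y"
  shows "fundamental_group X x \<cong> fundamental_group Y y"
proof -
  let ?h = "loop_homotopy X x" and ?k = "loop_homotopy Y y"
  have eqX: "equiv (loops X x) ?h" and eqY: "equiv (loops Y y) ?k"
    using X Y by (simp_all add: loop_calculus_def)
  define H where "H A = (\<Union>p\<in>A. ?k `` {\<phi> p})" for A
  have H: "H (?h `` {p}) = ?k `` {\<phi> p}" if p: "p \<in> loops X x" for p
  proof -
    have "?k `` {\<phi> p'} = ?k `` {\<phi> p}" if "p' \<in> ?h `` {p}" for p'
    proof -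
      have p': "(p, p') \<in> ?h" "p' \<in> loops X x"
        using that eqX by (auto simp: equiv_def refl_on_def)
      then have "(\<phi> p, \<phi> p') \<in> ?k" using hom p by blast
      then show ?thesis using equiv_class_eq[OF eqY] by metis
    qed
    moreover have "p \<in> ?h `` {p}" using equiv_class_self[OF eqX p] .
    ultimately show ?thesis unfolding H_def by blast
  qed
  have carX: "carrier (fundamental_group X x) = loops X x // ?h"
    and carY: "carrier (fundamental_group Y y) = loops Y y // ?k"
    by (simp_all add: fundamental_group_def)
  have "H \<in> iso (fundamental_group X x) (fundamental_group Y y)"
    unfolding iso_def hom_def mem_Collect_eq
  proof (intro conjI ballI)
    show "H \<in> carrier (fundamental_group X x) \<rightarrow> carrier (fundamental_group Y y)"
      unfolding carX carY using H \<phi> quotientI[of _ "loops Y y" ?k] by (auto elim!: quotientE)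
    fix A B assume "A \<in> carrier (fundamental_group X x)" "B \<in> carrier (fundamental_group X x)"
    then obtain p q where p: "p \<in> loops X x" "A = ?h `` {p}" and q: "q \<in> loops X x" "B = ?h `` {q}"
      unfolding carX by (auto elim!: quotientE)
    have pq: "loop_join p q \<in> loops X x" using X p q by (simp add: loop_calculus_def)
    have "H (A \<otimes>\<^bsub>fundamental_group X x\<^esub> B) = ?k `` {\<phi> (loop_join p q)}"
      using fundamental_group_mult_class[OF X p(1) q(1)] H[OF pq] p q by simp
    also have "\<dots> = ?k `` {loop_join (\<phi> p) (\<phi> q)}"
      using equiv_class_eq[OF eqY join[OF p(1) q(1)]] .
    also have "\<dots> = H A \<otimes>\<^bsub>fundamental_group Y y\<^esub> H B"
      using fundamental_group_mult_class[OF Y \<phi> \<phi>] p q H by simp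
    finally show "H (A \<otimes>\<^bsub>fundamental_group X x\<^esub> B) = H A \<otimes>\<^bsub>fundamental_group Y y\<^esub> H B" .
  next
    show "bij_betw H (carrier (fundamental_group X x)) (carrier (fundamental_group Y y))"
      unfolding carX carY bij_betw_def
    proof
      show "inj_on H (loops X x // ?h)"
      proof (rule inj_onI)
        fix A B assume "A \<in> loops X x // ?h" "B \<in> loops X x // ?h" and HAB: "H A = H B"
        then obtain p q where p: "p \<in> loops X x" "A = ?h `` {p}" and q: "q \<in> loops X x" "B = ?h `` {q}"
          by (auto elim!: quotientE)
        have "?k `` {\<phi> p} = ?k `` {\<phi> q}" using HAB H p q by simp
        then have "(\<phi> p, \<phi> q) \<in> ?k" using eq_equiv_class[OF _ eqY] \<phi> q by blast
        then have "(p, q) \<in> ?h" using hom p q by blast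
        then show "A = B" using equiv_class_eq[OF eqX] p q by blast
      qed
      show "H ` (loops X x // ?h) = loops Y y // ?k"
      proof
        show "H ` (loops X x // ?h) \<subseteq> loops Y y // ?k"
          using H \<phi> quotientI[of _ "loops Y y" ?k] by (auto elim!: quotientE)
        show "loops Y y // ?k \<subseteq> H ` (loops X x // ?h)"
        proof
          fix B assume "B \<in> loops Y y // ?k"
          then obtain q where q: "q \<in> loops Y y" "B = ?k `` {q}" by (auto elim!: quotientE)
          then obtain p where p: "p \<in> loops X x" "(\<phi> p, q) \<in> ?k" using surj by blast
          then have "H (?h `` {p}) = B" using H q equiv_class_eq[OF eqY] by metis
          moreover have "?h `` {p} \<in> loops X x // ?h" using p by (intro quotientI)
          ultimately show "B \<in> H ` (loops X x // ?h)" by blast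
        qed
      qed
    qed
  qed
  then show ?thesis unfolding is_iso_def by blast
qed

lemma loops_top_of_set:
  "p \<in> loops (top_of_set T) x \<longleftrightarrow> path p \<and> path_image p \<subseteq> T \<and> pathstart p = x \<and> pathfinish p = x"
  by (auto simp: loops_def pathin_canon_iff pathstart_def pathfinish_def path_image_def)

lemma loop_homotopy_top_of_set:
  "(p, q) \<in> loop_homotopy (top_of_set T) x \<longleftrightarrow> p \<in> loops (top_of_set T) x \<and> homotopic_paths T p q"
proof
  assume l: "(p, q) \<in> loop_homotopy (top_of_set T) x"
  then have "p 0 = x" "p 1 = x" by (auto simp: loop_homotopy_def loops_def)
  then show "p \<in> loops (top_of_set T) x \<and> homotopic_paths T p q"
    using l by (simp add: loop_homotopy_def homotopic_paths_def pathstart_def pathfinish_def)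
next
  assume r: "p \<in> loops (top_of_set T) x \<and> homotopic_paths T p q"
  then have p: "p 0 = x" "p 1 = x" by (auto simp: loops_def)
  have "q \<in> loops (top_of_set T) x"
    using r homotopic_paths_imp_path[of T p q] homotopic_paths_imp_subset[of T p q]
      homotopic_paths_imp_pathstart[of T p q] homotopic_paths_imp_pathfinish[of T p q]
    by (simp add: loops_top_of_set)
  then show "(p, q) \<in> loop_homotopy (top_of_set T) x"
    using r p by (simp add: loop_homotopy_def homotopic_paths_def pathstart_def pathfinish_def)
qed

lemma loop_join_eq_joinpaths: "loop_join p q = p +++ q"
  by (simp add: loop_join_def joinpaths_def)

lemma loop_calculus_top_of_set:
  fixes T :: "'a::real_normed_vector set"
  shows "loop_calculus (top_of_set T) x"
  unfolding loop_calculus_def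
proof (intro conjI ballI allI impI)
  show "equiv (loops (top_of_set T) x) (loop_homotopy (top_of_set T) x)"
    by (rule equiv_loop_homotopy)
  show "loop_join p q \<in> loops (top_of_set T) x"
    if "p \<in> loops (top_of_set T) x" "q \<in> loops (top_of_set T) x" for p q
    using that by (simp add: loops_top_of_set loop_join_eq_joinpaths subset_path_image_join)
  show "(loop_join p q, loop_join p' q') \<in> loop_homotopy (top_of_set T) x"
    if "(p, p') \<in> loop_homotopy (top_of_set T) x" "(q, q') \<in> loop_homotopy (top_of_set T) x" for p p' q q'
    using that homotopic_paths_join[of T p p' q q']
    by (simp add: loop_homotopy_top_of_set loops_top_of_set loop_join_eq_joinpaths subset_path_image_join)
qed

lemma loop_transport:
  assumes f: "homeomorphic_maps X Y f g" and x: "x \<in> topspace X" and p: "p \<in> loops X x"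
  shows "f \<circ> p \<in> loops Y (f x)"
  using assms by (auto simp: loops_def homeomorphic_maps_def intro: pathin_compose)

lemma loop_homotopy_transport:
  assumes f: "homeomorphic_maps X Y f g" and p: "(p, q) \<in> loop_homotopy X x"
  shows "(f \<circ> p, f \<circ> q) \<in> loop_homotopy Y (f x)"
proof -
  have "homotopic_with (\<lambda>r. r 0 = f x \<and> r 1 = f x) (top_of_set {0..1}) Y (f \<circ> p) (f \<circ> q)"
    by (rule homotopic_with_compose_continuous_map_left[where p="\<lambda>r. r 0 = x \<and> r 1 = x" and ?X2.0 = X])
      (use f p in \<open>auto simp: loop_homotopy_def homeomorphic_maps_def\<close>)
  moreover have "x \<in> topspace X"
    using p by (auto simp: loop_homotopy_def loops_def dest: path_start_in_topspace)
  ultimately show ?thesis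
    using p loop_transport[OF f] by (simp add: loop_homotopy_def)
qed

lemma loops_eq_on_unit_interval:
  assumes p: "p \<in> loops X x" and eq: "\<And>t. t \<in> {0..1} \<Longrightarrow> q t = p t"
  shows "q \<in> loops X x"
  using assms continuous_map_eq[of "top_of_set {0..1}" X p q] by (auto simp: loops_def pathin_def)

text \<open>Loops are functions on all of \<open>\<real>\<close>, and transporting a loop to a homeomorphic space and back may change
  its values outside the unit interval; the homotopy class does not see this.\<close>

lemma loop_homotopy_eq_on_unit_interval:
  assumes p: "(p, q) \<in> loop_homotopy X x"
    and eq: "\<And>t. t \<in> {0..1} \<Longrightarrow> p' t = p t" "\<And>t. t \<in> {0..1} \<Longrightarrow> q' t = q t"
  shows "(p', q') \<in> loop_homotopy X x"
proof -
  have "p' \<in> loops X x" "q' \<in> loops X x"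
    using p loops_eq_on_unit_interval[of p X x p', OF _ eq(1)] loops_eq_on_unit_interval[of q X x q', OF _ eq(2)]
    by (simp_all add: loop_homotopy_def)
  moreover have "homotopic_with (\<lambda>r. r 0 = x \<and> r 1 = x) (top_of_set {0..1}) X p' q'"
    by (rule homotopic_with_eq[of _ _ _ p q]) (use p eq in \<open>auto simp: loop_homotopy_def\<close>)
  ultimately show ?thesis by (simp add: loop_homotopy_def)
qed

lemma comp_loop_join: "f \<circ> loop_join p q = loop_join (f \<circ> p) (f \<circ> q)"
  by (auto simp: loop_join_def)

lemma loops_in_topspace: "p \<in> loops X x \<Longrightarrow> t \<in> {0..1} \<Longrightarrow> p t \<in> topspace X"
  by (auto simp: loops_def pathin_def continuous_map_def)

lemma loop_homotopy_transport_iff: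
  assumes f: "homeomorphic_maps X Y f g" and p: "p \<in> loops X x" and q: "q \<in> loops X x"
  shows "(p, q) \<in> loop_homotopy X x \<longleftrightarrow> (f \<circ> p, f \<circ> q) \<in> loop_homotopy Y (f x)"
proof
  assume "(f \<circ> p, f \<circ> q) \<in> loop_homotopy Y (f x)"
  then have "(g \<circ> (f \<circ> p), g \<circ> (f \<circ> q)) \<in> loop_homotopy X (g (f x))"
    by (rule loop_homotopy_transport[OF homeomorphic_maps_sym[THEN iffD1, OF f]])
  moreover have "g (f y) = y" if "y \<in> topspace X" for y
    using f that by (auto simp: homeomorphic_maps_def)
  moreover have "x \<in> topspace X"
    using p path_start_in_topspace by (auto simp: loops_def)
  ultimately show "(p, q) \<in> loop_homotopy X x"
    using loop_homotopy_eq_on_unit_interval[of "g \<circ> (f \<circ> p)" "g \<circ> (f \<circ> q)" X x p q] loops_in_topspace p q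
    by (metis comp_apply)
qed (rule loop_homotopy_transport[OF f])

lemma fundamental_group_homeomorphic_maps:
  assumes f: "homeomorphic_maps X Y f g" and x: "x \<in> topspace X" and Y: "loop_calculus Y (f x)"
  shows "loop_calculus X x" "fundamental_group X x \<cong> fundamental_group Y (f x)"
proof -
  have gf: "g (f y) = y" if "y \<in> topspace X" for y
    using f that by (auto simp: homeomorphic_maps_def)
  have fg: "f (g y) = y" if "y \<in> topspace Y" for y
    using f that by (auto simp: homeomorphic_maps_def)
  have fx: "f x \<in> topspace Y" using f x by (auto simp: homeomorphic_maps_def continuous_map_def)
  have pull: "g \<circ> q \<in> loops X x" if "q \<in> loops Y (f x)" for q
    using loop_transport[OF homeomorphic_maps_sym[THEN iffD1, OF f] fx that] gf[OF x] by simp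
  have join: "loop_join p q \<in> loops X x" if p: "p \<in> loops X x" and q: "q \<in> loops X x" for p q
  proof -
    have "loop_join (f \<circ> p) (f \<circ> q) \<in> loops Y (f x)"
      using Y loop_transport[OF f x] p q by (simp add: loop_calculus_def)
    then have "g \<circ> loop_join (f \<circ> p) (f \<circ> q) \<in> loops X x" by (rule pull)
    then show ?thesis
    proof (rule loops_eq_on_unit_interval)
      fix t :: real assume "t \<in> {0..1}"
      then show "loop_join p q t = (g \<circ> loop_join (f \<circ> p) (f \<circ> q)) t"
        using gf loops_in_topspace[OF p, of "2 * t"] loops_in_topspace[OF q, of "2 * t - 1"]
        by (auto simp: loop_join_def)
    qed
  qed
  show X: "loop_calculus X x"
    unfolding loop_calculus_def
  proof (intro conjI ballI allI impI equiv_loop_homotopy join)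
    fix p p' q q' assume pq: "(p, p') \<in> loop_homotopy X x" "(q, q') \<in> loop_homotopy X x"
    then have l: "p \<in> loops X x" "p' \<in> loops X x" "q \<in> loops X x" "q' \<in> loops X x"
      by (auto simp: loop_homotopy_def)
    have "(loop_join (f \<circ> p) (f \<circ> q), loop_join (f \<circ> p') (f \<circ> q')) \<in> loop_homotopy Y (f x)"
      using Y pq loop_homotopy_transport[OF f] unfolding loop_calculus_def by blast
    then show "(loop_join p q, loop_join p' q') \<in> loop_homotopy X x"
      using loop_homotopy_transport_iff[OF f join join] l comp_loop_join by metis
  qed
  show "fundamental_group X x \<cong> fundamental_group Y (f x)"
  proof (rule fundamental_group_isoI[OF X Y loop_transport[OF f x]])
    show "((p, q) \<in> loop_homotopy X x) = ((f \<circ> p, f \<circ> q) \<in> loop_homotopy Y (f x))"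
      if "p \<in> loops X x" "q \<in> loops X x" for p q
      using loop_homotopy_transport_iff[OF f that] .
    show "(f \<circ> loop_join p q, loop_join (f \<circ> p) (f \<circ> q)) \<in> loop_homotopy Y (f x)"
      if "p \<in> loops X x" "q \<in> loops X x" for p q
      using equiv_loop_homotopy[of Y "f x"] loop_transport[OF f x join[OF that]]
      unfolding comp_loop_join equiv_def refl_on_def by blast
    show "\<exists>p\<in>loops X x. (f \<circ> p, q) \<in> loop_homotopy Y (f x)" if q: "q \<in> loops Y (f x)" for q
    proof
      show "g \<circ> q \<in> loops X x" by (rule pull[OF q])
      have "(q, q) \<in> loop_homotopy Y (f x)"
        using equiv_loop_homotopy[of Y "f x"] q unfolding equiv_def refl_on_def by blast
      then show "(f \<circ> (g \<circ> q), q) \<in> loop_homotopy Y (f x)"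
        by (rule loop_homotopy_eq_on_unit_interval) (use fg loops_in_topspace[OF q] in auto)
    qed
  qed
qed

lemma homotopic_paths_join_left:
  assumes "path p" "path_image p \<subseteq> T" "pathfinish p = pathstart q" "homotopic_paths T q q'"
  shows "homotopic_paths T (p +++ q) (p +++ q')"
  using assms by (intro homotopic_paths_join) auto

lemma homotopic_paths_cancel_left:
  fixes T :: "'a::real_normed_vector set"
  assumes "path \<gamma>" "path_image \<gamma> \<subseteq> T" "path p" "path_image p \<subseteq> T" "pathfinish \<gamma> = pathstart p"
  shows "homotopic_paths T (reversepath \<gamma> +++ (\<gamma> +++ p)) p"
proof -
  have "homotopic_paths T (reversepath \<gamma> +++ (\<gamma> +++ p)) ((reversepath \<gamma> +++ \<gamma>) +++ p)"
    using assms by (intro homotopic_paths_assoc) auto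
  also have "homotopic_paths T \<dots> (linepath (pathstart p) (pathstart p) +++ p)"
    using homotopic_paths_linv[of \<gamma> T] assms by (intro homotopic_paths_join) auto
  also have "homotopic_paths T \<dots> p"
    using assms by (intro homotopic_paths_lid) auto
  finally show ?thesis .
qed

lemma homotopic_paths_cancel_right:
  fixes T :: "'a::real_normed_vector set"
  assumes "path \<gamma>" "path_image \<gamma> \<subseteq> T" "path p" "path_image p \<subseteq> T" "pathfinish \<gamma> = pathfinish p"
  shows "homotopic_paths T ((p +++ reversepath \<gamma>) +++ \<gamma>) p"
proof -
  have "homotopic_paths T ((p +++ reversepath \<gamma>) +++ \<gamma>) (p +++ (reversepath \<gamma> +++ \<gamma>))"
    using assms by (intro homotopic_paths_sym[OF homotopic_paths_assoc]) auto
  also have "homotopic_paths T \<dots> (p +++ linepath (pathfinish p) (pathfinish p))"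
    using homotopic_paths_linv[of \<gamma> T] assms by (intro homotopic_paths_join) auto
  also have "homotopic_paths T \<dots> p"
    using assms by (intro homotopic_paths_rid) auto
  finally show ?thesis .
qed

lemma homotopic_paths_conjugate_back:
  fixes T :: "'a::real_normed_vector set"
  assumes \<gamma>: "path \<gamma>" "path_image \<gamma> \<subseteq> T"
    and p: "path p" "path_image p \<subseteq> T" "pathstart p = pathfinish \<gamma>" "pathfinish p = pathfinish \<gamma>"
  shows "homotopic_paths T (reversepath \<gamma> +++ ((\<gamma> +++ (p +++ reversepath \<gamma>)) +++ \<gamma>)) p"
proof -
  have "homotopic_paths T ((\<gamma> +++ (p +++ reversepath \<gamma>)) +++ \<gamma>) (\<gamma> +++ ((p +++ reversepath \<gamma>) +++ \<gamma>))"
    using assms by (intro homotopic_paths_sym[OF homotopic_paths_assoc]) (auto simp: subset_path_image_join)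
  also have "homotopic_paths T \<dots> (\<gamma> +++ p)"
    by (rule homotopic_paths_join_left) (use assms in \<open>auto intro: homotopic_paths_cancel_right\<close>)
  finally have "homotopic_paths T (reversepath \<gamma> +++ ((\<gamma> +++ (p +++ reversepath \<gamma>)) +++ \<gamma>)) (reversepath \<gamma> +++ (\<gamma> +++ p))"
    by (rule homotopic_paths_join_left[rotated 3]) (use assms in auto)
  also have "homotopic_paths T \<dots> p"
    using assms by (intro homotopic_paths_cancel_left) auto
  finally show ?thesis .
qed

lemma homotopic_paths_conjugate_join:
  fixes T :: "'a::real_normed_vector set"
  assumes \<gamma>: "path \<gamma>" "path_image \<gamma> \<subseteq> T"
    and p: "path p" "path_image p \<subseteq> T" "pathstart p = pathfinish \<gamma>" "pathfinish p = pathfinish \<gamma>"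
    and q: "path q" "path_image q \<subseteq> T" "pathstart q = pathfinish \<gamma>" "pathfinish q = pathfinish \<gamma>"
  shows "homotopic_paths T (\<gamma> +++ ((p +++ q) +++ reversepath \<gamma>))
     ((\<gamma> +++ (p +++ reversepath \<gamma>)) +++ (\<gamma> +++ (q +++ reversepath \<gamma>)))"
proof (rule homotopic_paths_sym)
  have "homotopic_paths T ((\<gamma> +++ (p +++ reversepath \<gamma>)) +++ (\<gamma> +++ (q +++ reversepath \<gamma>)))
     (\<gamma> +++ ((p +++ reversepath \<gamma>) +++ (\<gamma> +++ (q +++ reversepath \<gamma>))))"
    using assms by (intro homotopic_paths_sym[OF homotopic_paths_assoc]) (auto simp: subset_path_image_join)
  also have "homotopic_paths T \<dots> (\<gamma> +++ ((p +++ q) +++ reversepath \<gamma>))"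
  proof (rule homotopic_paths_join_left)
    have cancel: "homotopic_paths T (reversepath \<gamma> +++ (\<gamma> +++ (q +++ reversepath \<gamma>))) (q +++ reversepath \<gamma>)"
      by (rule homotopic_paths_cancel_left) (use assms in \<open>auto simp: subset_path_image_join\<close>)
    have "homotopic_paths T ((p +++ reversepath \<gamma>) +++ (\<gamma> +++ (q +++ reversepath \<gamma>)))
       (p +++ (reversepath \<gamma> +++ (\<gamma> +++ (q +++ reversepath \<gamma>))))"
      using assms by (intro homotopic_paths_sym[OF homotopic_paths_assoc]) (auto simp: subset_path_image_join)
    also have "homotopic_paths T \<dots> (p +++ (q +++ reversepath \<gamma>))"
      by (rule homotopic_paths_join_left[OF _ _ _ cancel]) (use assms in auto)
    also have "homotopic_paths T \<dots> ((p +++ q) +++ reversepath \<gamma>)"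
      using assms by (intro homotopic_paths_assoc) auto
    finally show "homotopic_paths T ((p +++ reversepath \<gamma>) +++ (\<gamma> +++ (q +++ reversepath \<gamma>))) ((p +++ q) +++ reversepath \<gamma>)" .
  qed (use assms in auto)
  finally show "homotopic_paths T ((\<gamma> +++ (p +++ reversepath \<gamma>)) +++ (\<gamma> +++ (q +++ reversepath \<gamma>)))
    (\<gamma> +++ ((p +++ q) +++ reversepath \<gamma>))" .
qed

lemma fundamental_group_change_base_point:
  fixes T :: "'a::real_normed_vector set"
  assumes T: "path_connected T" and xy: "x \<in> T" "y \<in> T"
  shows "fundamental_group (top_of_set T) x \<cong> fundamental_group (top_of_set T) y"
proof -
  obtain \<gamma> where \<gamma>: "path \<gamma>" "path_image \<gamma> \<subseteq> T" "pathstart \<gamma> = y" "pathfinish \<gamma> = x"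
    using T xy unfolding path_connected_def by blast
  define \<phi> where "\<phi> p = \<gamma> +++ (p +++ reversepath \<gamma>)" for p
  define \<psi> where "\<psi> p = reversepath \<gamma> +++ (p +++ \<gamma>)" for p
  have \<phi>: "\<phi> p \<in> loops (top_of_set T) y" if "p \<in> loops (top_of_set T) x" for p
    using that \<gamma> by (auto simp: loops_top_of_set \<phi>_def subset_path_image_join)
  have \<psi>: "\<psi> p \<in> loops (top_of_set T) x" if "p \<in> loops (top_of_set T) y" for p
    using that \<gamma> by (auto simp: loops_top_of_set \<psi>_def subset_path_image_join)
  have \<phi>h: "homotopic_paths T (\<phi> p) (\<phi> q)"
    if "p \<in> loops (top_of_set T) x" "homotopic_paths T p q" for p q
    unfolding \<phi>_def using that \<gamma>
      homotopic_paths_imp_pathstart[OF that(2)] homotopic_paths_imp_pathfinish[OF that(2)]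
    by (intro homotopic_paths_join) (auto simp: loops_top_of_set)
  have \<psi>h: "homotopic_paths T (\<psi> p) (\<psi> q)"
    if "p \<in> loops (top_of_set T) y" "homotopic_paths T p q" for p q
    unfolding \<psi>_def using that \<gamma>
      homotopic_paths_imp_pathstart[OF that(2)] homotopic_paths_imp_pathfinish[OF that(2)]
    by (intro homotopic_paths_join) (auto simp: loops_top_of_set)
  have \<psi>\<phi>: "homotopic_paths T (reversepath \<gamma> +++ ((\<gamma> +++ (p +++ reversepath \<gamma>)) +++ \<gamma>)) p"
    if "p \<in> loops (top_of_set T) x" for p
    using that \<gamma> by (intro homotopic_paths_conjugate_back) (auto simp: loops_top_of_set)
  have \<phi>\<psi>: "homotopic_paths T (\<phi> (\<psi> p)) p" if "p \<in> loops (top_of_set T) y" for p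
    using that \<gamma> homotopic_paths_conjugate_back[of "reversepath \<gamma>" T p]
    by (simp add: loops_top_of_set \<phi>_def \<psi>_def)
  show ?thesis
  proof (rule fundamental_group_isoI[OF loop_calculus_top_of_set loop_calculus_top_of_set \<phi>])
    fix p q assume p: "p \<in> loops (top_of_set T) x" and q: "q \<in> loops (top_of_set T) x"
    show "((p, q) \<in> loop_homotopy (top_of_set T) x) = ((\<phi> p, \<phi> q) \<in> loop_homotopy (top_of_set T) y)"
    proof
      assume "(\<phi> p, \<phi> q) \<in> loop_homotopy (top_of_set T) y"
      then have "homotopic_paths T (\<psi> (\<phi> p)) (\<psi> (\<phi> q))"
        using \<psi>h by (simp add: loop_homotopy_top_of_set)
      then have "homotopic_paths T p q"
        using \<psi>\<phi>[OF p] \<psi>\<phi>[OF q] unfolding \<psi>_def \<phi>_def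
        by (meson homotopic_paths_sym homotopic_paths_trans)
      then show "(p, q) \<in> loop_homotopy (top_of_set T) x" using p by (simp add: loop_homotopy_top_of_set)
    qed (use \<phi> \<phi>h p q in \<open>auto simp: loop_homotopy_top_of_set\<close>)
    have "homotopic_paths T (\<phi> (p +++ q)) (\<phi> p +++ \<phi> q)"
      unfolding \<phi>_def using p q \<gamma> by (intro homotopic_paths_conjugate_join) (auto simp: loops_top_of_set)
    moreover have "p +++ q \<in> loops (top_of_set T) x"
      using p q by (simp add: loops_top_of_set subset_path_image_join)
    ultimately show "(\<phi> (loop_join p q), loop_join (\<phi> p) (\<phi> q)) \<in> loop_homotopy (top_of_set T) y"
      using \<phi> by (simp add: loop_homotopy_top_of_set loop_join_eq_joinpaths)
  next
    fix q assume q: "q \<in> loops (top_of_set T) y"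
    then show "\<exists>p\<in>loops (top_of_set T) x. (\<phi> p, q) \<in> loop_homotopy (top_of_set T) y"
      using \<phi>\<psi> \<phi> \<psi> by (auto simp: loop_homotopy_top_of_set)
  qed
qed

section \<open>Removing a countable compact set keeps the fundamental group\<close>

lemma path_push_off:
  fixes T :: "'a::euclidean_space set" and c :: "'a \<Rightarrow> 'n::euclidean_space"
  assumes dim: "2 < DIM('n)" and U: "openin (top_of_set T) U" and V: "open V" and c: "homeomorphism U V c c'"
    and A: "A \<subseteq> U" "compact A" "countable A"
    and p: "path p" "path_image p \<subseteq> T" "pathstart p \<notin> A" "pathfinish p \<notin> A"
  obtains q where "path q" "path_image q \<subseteq> T - A" "homotopic_paths T p q"
proof -
  obtain h :: "real \<times> real \<Rightarrow> 'a" where h: "continuous_on ({0..1} \<times> {0..1}) h" "h \<in> {0..1} \<times> {0..1} \<rightarrow> T"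
    "\<forall>x\<in>{0..1}. h (0, x) = p x" "\<forall>x\<in>{0..1}. h (1, x) \<notin> A" "\<forall>x\<in>{0, 1}. \<forall>t. h (t, x) = p x"
  proof -
    have "\<exists>h :: real \<times> real \<Rightarrow> 'a. continuous_on ({0..1} \<times> {0..1}) h \<and> h \<in> {0..1} \<times> {0..1} \<rightarrow> T \<and>
      (\<forall>x\<in>{0..1}. h (0, x) = p x) \<and> (\<forall>x\<in>{0..1}. h (1, x) \<notin> A) \<and> (\<forall>x\<in>{0, 1}. \<forall>t. h (t, x) = p x)"
      by (rule push_off_countable_set[OF _ _ _ _ _ _ _ U V c A])
        (use dim p in \<open>auto simp: path_def path_image_def pathstart_def pathfinish_def\<close>)
    then show thesis using that by blast
  qed
  define q where "q x = h (1, x)" for x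
  have hom: "homotopic_paths T p q"
    unfolding homotopic_paths
  proof (intro exI[of _ h] conjI ballI)
    show "pathstart (h \<circ> Pair t) = pathstart p" "pathfinish (h \<circ> Pair t) = pathfinish p" for t
      using h(5) by (auto simp: pathstart_def pathfinish_def)
  qed (use h in \<open>auto simp: q_def\<close>)
  moreover have "path_image q \<subseteq> T - A"
    using h(2,4) by (force simp: path_image_def q_def)
  ultimately show thesis
    using that homotopic_paths_imp_path by blast
qed

text \<open>A homotopy is a map of a square, of dimension 2, so that it can be pushed off a countable set with
  its values on the boundary of the square kept.\<close>

lemma homotopic_paths_push_off:
  fixes T :: "'a::euclidean_space set" and c :: "'a \<Rightarrow> 'n::euclidean_space"
  assumes dim: "2 < DIM('n)" and U: "openin (top_of_set T) U" and V: "open V" and c: "homeomorphism U V c c'"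
    and A: "A \<subseteq> U" "compact A" "countable A"
    and pq: "homotopic_paths T p q" and p: "path_image p \<subseteq> T - A" and q: "path_image q \<subseteq> T - A"
  shows "homotopic_paths (T - A) p q"
proof -
  let ?I = "{0..1::real} \<times> {0..1::real}"
  let ?B = "{0, 1::real} \<times> {0..1::real} \<union> {0..1} \<times> {0, 1}"
  obtain k :: "real \<times> real \<Rightarrow> 'a" where k: "continuous_on ?I k" "k \<in> ?I \<rightarrow> T" "\<forall>x\<in>{0..1}. k (0, x) = p x" "\<forall>x\<in>{0..1}. k (1, x) = q x"
    "\<forall>t\<in>{0..1}. k (t, 0) = p 0 \<and> k (t, 1) = p 1"
    using pq unfolding homotopic_paths by (auto simp: pathstart_def pathfinish_def)
  have B: "k y \<notin> A" if "y \<in> ?B" for y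
  proof -
    have "p t \<notin> A \<and> q t \<notin> A" if "t \<in> {0..1}" for t
      using p q that by (auto simp: path_image_def image_subset_iff)
    then show ?thesis using that k(3-5) by auto
  qed
  have "\<exists>h :: real \<times> (real \<times> real) \<Rightarrow> 'a. continuous_on ({0..1} \<times> ?I) h \<and> h \<in> {0..1} \<times> ?I \<rightarrow> T \<and>
    (\<forall>x\<in>?I. h (0, x) = k x) \<and> (\<forall>x\<in>?I. h (1, x) \<notin> A) \<and> (\<forall>x\<in>?B. \<forall>t. h (t, x) = k x)"
  proof (rule push_off_countable_set[OF _ _ _ _ _ _ _ U V c A])
    show "compact ?I" "compact ?B" by (auto intro!: compact_Times compact_Un)
    show "k ` ?I \<subseteq> T" using k(2) by blast
    show "k ` ?B \<inter> A = {}" using B by blast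
    show "DIM(real \<times> real) < DIM('n)" using dim by simp
  qed (use k in auto)
  then obtain h :: "real \<times> (real \<times> real) \<Rightarrow> 'a" where h: "continuous_on ({0..1} \<times> ?I) h" "h \<in> {0..1} \<times> ?I \<rightarrow> T"
    "\<forall>x\<in>?I. h (1, x) \<notin> A" "\<forall>x\<in>?B. \<forall>t. h (t, x) = k x"
    by blast
  show ?thesis
    unfolding homotopic_paths
  proof (intro exI[of _ "\<lambda>x. h (1, x)"] conjI ballI)
    show "continuous_on ?I (\<lambda>x. h (1, x))"
      by (intro continuous_on_compose2[OF h(1)] continuous_intros) auto
    show "(\<lambda>x. h (1, x)) \<in> ?I \<rightarrow> T - A"
      using h(2,3) by (simp add: Pi_iff)
  qed (use h(4) k(3-5) in \<open>auto simp: pathstart_def pathfinish_def\<close>)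
qed

lemma path_connected_minus_countable_in_chart:
  fixes T :: "'a::euclidean_space set" and c :: "'a \<Rightarrow> 'n::euclidean_space"
  assumes dim: "2 < DIM('n)" and U: "openin (top_of_set T) U" and V: "open V" and c: "homeomorphism U V c c'"
    and A: "A \<subseteq> U" "compact A" "countable A"
    and T: "path_connected T"
  shows "path_connected (T - A)"
  unfolding path_connected_def
proof (intro ballI)
  fix x y assume xy: "x \<in> T - A" "y \<in> T - A"
  then obtain p where p: "path p" "path_image p \<subseteq> T" "pathstart p = x" "pathfinish p = y"
    using T unfolding path_connected_def by blast
  obtain q where q: "path q" "path_image q \<subseteq> T - A" "homotopic_paths T p q"
    by (rule path_push_off[OF dim U V c A p(1,2)]) (use p xy in auto)
  then show "\<exists>g. path g \<and> path_image g \<subseteq> T - A \<and> pathstart g = x \<and> pathfinish g = y"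
    using homotopic_paths_imp_pathstart homotopic_paths_imp_pathfinish p by metis
qed

lemma fundamental_group_minus_countable_in_chart:
  fixes T :: "'a::euclidean_space set" and c :: "'a \<Rightarrow> 'n::euclidean_space"
  assumes dim: "2 < DIM('n)" and U: "openin (top_of_set T) U" and V: "open V" and c: "homeomorphism U V c c'"
    and A: "A \<subseteq> U" "compact A" "countable A"
    and x: "x \<in> T - A"
  shows "fundamental_group (top_of_set (T - A)) x \<cong> fundamental_group (top_of_set T) x"
proof (rule fundamental_group_isoI[OF loop_calculus_top_of_set loop_calculus_top_of_set, where \<phi> = "\<lambda>p. p"])
  show l: "p \<in> loops (top_of_set T) x" if "p \<in> loops (top_of_set (T - A)) x" for p
    using that by (auto simp: loops_top_of_set)
  show "((p, q) \<in> loop_homotopy (top_of_set (T - A)) x) = ((p, q) \<in> loop_homotopy (top_of_set T) x)"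
    if "p \<in> loops (top_of_set (T - A)) x" "q \<in> loops (top_of_set (T - A)) x" for p q
  proof
    assume "(p, q) \<in> loop_homotopy (top_of_set (T - A)) x"
    then show "(p, q) \<in> loop_homotopy (top_of_set T) x"
      using l[OF that(1)] homotopic_paths_subset[of "T - A" p q T] by (auto simp: loop_homotopy_top_of_set)
  next
    assume "(p, q) \<in> loop_homotopy (top_of_set T) x"
    then show "(p, q) \<in> loop_homotopy (top_of_set (T - A)) x"
      using that homotopic_paths_push_off[OF dim U V c A, of p q]
      by (simp add: loop_homotopy_top_of_set loops_top_of_set)
  qed
  show "(loop_join p q, loop_join p q) \<in> loop_homotopy (top_of_set T) x"
    if "p \<in> loops (top_of_set (T - A)) x" "q \<in> loops (top_of_set (T - A)) x" for p q
    using l[OF that(1)] l[OF that(2)]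
    by (simp add: loop_homotopy_top_of_set loops_top_of_set loop_join_eq_joinpaths subset_path_image_join)
  show "\<exists>p\<in>loops (top_of_set (T - A)) x. (p, q) \<in> loop_homotopy (top_of_set T) x"
    if "q \<in> loops (top_of_set T) x" for q
  proof -
    have q: "path q" "path_image q \<subseteq> T" "pathstart q = x" "pathfinish q = x"
      using that by (auto simp: loops_top_of_set)
    obtain p where p: "path p" "path_image p \<subseteq> T - A" "homotopic_paths T q p"
      by (rule path_push_off[OF dim U V c A q(1,2)]) (use q x in auto)
    then have "pathstart p = x" "pathfinish p = x"
      using homotopic_paths_imp_pathstart homotopic_paths_imp_pathfinish q by metis+
    then have "p \<in> loops (top_of_set (T - A)) x" using p by (simp add: loops_top_of_set)
    moreover have "(p, q) \<in> loop_homotopy (top_of_set T) x"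
      using calculation l p(3) homotopic_paths_sym by (simp add: loop_homotopy_top_of_set)
    ultimately show ?thesis by blast
  qed
qed

section \<open>Countable compact sets\<close>

lemma uncountable_bool_sequences: "uncountable (UNIV :: (nat \<Rightarrow> bool) set)"
proof
  assume "countable (UNIV :: (nat \<Rightarrow> bool) set)"
  then obtain f :: "nat \<Rightarrow> nat \<Rightarrow> bool" where f: "range f = UNIV"
    using uncountable_def by blast
  obtain n where "f n = (\<lambda>k. \<not> f k k)"
    using f by (metis UNIV_I imageE)
  then have "f n n = (\<not> f n n)" by (rule fun_cong[of _ _ n, THEN trans]) simp
  then show False by simp
qed

text \<open>Two disjoint copies of \<open>K\<close> inside \<open>K\<close> can be iterated: every binary sequence \<open>s\<close> gives a nested sequence of
  copies of \<open>K\<close>, whose intersection is nonempty by compactness, and different sequences give disjoint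
  intersections. So \<open>K\<close> would be uncountable.\<close>

lemma countable_compact_no_disjoint_self_embeddings:
  fixes K :: "'a::heine_borel set"
  assumes K: "compact K" "countable K" "K \<noteq> {}"
    and f: "\<And>b. continuous_on K (f b)" "\<And>b. inj_on (f b) K" "\<And>b. f b ` K \<subseteq> K"
  shows "f False ` K \<inter> f True ` K \<noteq> {}"
proof
  assume disj: "f False ` K \<inter> f True ` K = {}"
  \<comment> \<open>g s n is the composition of f (s 0), ..., f (s (n - 1)), with f (s 0) applied last\<close>
  define g where "g s n = rec_nat (\<lambda>x. x) (\<lambda>k r x. r (f (s k) x)) n" for s :: "nat \<Rightarrow> bool" and n :: nat
  have g0: "g s 0 = (\<lambda>x. x)" and gS: "g s (Suc n) = (\<lambda>x. g s n (f (s n) x))" for s n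
    by (simp_all add: g_def)
  have gc: "continuous_on K (g s n) \<and> inj_on (g s n) K \<and> g s n ` K \<subseteq> K" for s n
  proof (induction n)
    case 0 then show ?case by (auto simp: g0 inj_on_def)
  next
    case (Suc n)
    have "continuous_on K (\<lambda>x. g s n (f (s n) x))"
      by (rule continuous_on_compose2[of K "g s n"]) (use Suc f in auto)
    moreover have "inj_on (\<lambda>x. g s n (f (s n) x)) K"
      using comp_inj_on[of "f (s n)" K "g s n"] Suc f inj_on_subset[of "g s n" K "f (s n) ` K"] by (simp add: comp_def)
    moreover have "(\<lambda>x. g s n (f (s n) x)) ` K \<subseteq> K"
      using Suc f(3) by (auto simp: image_subset_iff)
    ultimately show ?case by (simp add: gS)
  qed
  have dec: "g s (Suc n) ` K \<subseteq> g s n ` K" for s n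
    using f(3) by (auto simp: gS image_subset_iff)
  have mono: "g s n ` K \<subseteq> g s m ` K" if "m \<le> n" for s m n
    using that by (rule lift_Suc_antimono_le[rotated]) (rule dec)
  have cong: "g s n = g s' n" if "\<And>k. k < n \<Longrightarrow> s k = s' k" for s s' n
    using that by (induction n) (auto simp: g0 gS fun_eq_iff)
  have "\<Inter>(range (\<lambda>n. g s n ` K)) \<noteq> {}" for s
  proof (rule compact_nest)
    show "compact (g s n ` K)" for n using gc K(1) compact_continuous_image by blast
  qed (use K(3) mono in auto)
  then have "\<forall>s. \<exists>x. x \<in> (\<Inter>n. g s n ` K)" by (simp only: ex_in_conv simp_thms)
  from choice[OF this] obtain x where x_all: "\<forall>s. x s \<in> (\<Inter>n. g s n ` K)" by (rule exE)
  have x: "x s \<in> g s n ` K" for s n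
    using x_all[rule_format, of s] by (rule INT_D) simp
  have "inj x"
  proof (rule injI, rule ccontr)
    fix s s' assume xs: "x s = x s'" and "s \<noteq> s'"
    define n where "n = (LEAST k. s k \<noteq> s' k)"
    have "\<exists>k. s k \<noteq> s' k" using \<open>s \<noteq> s'\<close> by (simp add: fun_eq_iff)
    then have n: "s n \<noteq> s' n" unfolding n_def by (rule LeastI_ex[of "\<lambda>k. s k \<noteq> s' k"])
    have gn: "g s n = g s' n"
      using not_less_Least[of _ "\<lambda>k. s k \<noteq> s' k"] unfolding n_def by (intro cong) blast
    obtain u where u: "u \<in> K" "x s = g s n (f (s n) u)" using x[of s "Suc n"] by (auto simp: gS)
    obtain w where w: "w \<in> K" "x s' = g s n (f (s' n) w)" using x[of s' "Suc n"] by (auto simp: gS gn)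
    have "f (s n) u = f (s' n) w"
      by (rule inj_onD[of "g s n" K]) (use gc u w xs gn f(3) in \<open>auto simp: image_subset_iff\<close>)
    then show False using disj n u(1) w(1) by (cases "s n"; cases "s' n") auto
  qed
  moreover have "range x \<subseteq> K" using x[of _ 0] by (auto simp: g0)
  ultimately show False
    using uncountable_bool_sequences countable_image_inj_on countable_subset[OF _ K(2)] by blast
qed

lemma compact_sequence_to_point:
  fixes C :: "nat \<Rightarrow> 'a::metric_space set"
  assumes C: "\<And>n. compact (C n)" and lim: "\<And>e. e > 0 \<Longrightarrow> \<exists>N. \<forall>n\<ge>N. C n \<subseteq> ball v e"
  shows "compact (insert v (\<Union>n. C n))"
proof (rule compactI)
  fix F assume F: "\<forall>t\<in>F. open t" "insert v (\<Union>n. C n) \<subseteq> \<Union>F"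
  then obtain U where U: "U \<in> F" "v \<in> U" by blast
  then obtain e where e: "e > 0" "ball v e \<subseteq> U" using F open_contains_ball by blast
  then obtain N where N: "\<forall>n\<ge>N. C n \<subseteq> U" using lim by (meson subset_trans)
  have "compact (\<Union>n<N. C n)" using C by (intro compact_UN) auto
  moreover have "(\<Union>n<N. C n) \<subseteq> \<Union>F" using F by blast
  ultimately obtain G where G: "G \<subseteq> F" "finite G" "(\<Union>n<N. C n) \<subseteq> \<Union>G"
    using F(1) by (meson compactE subset_eq)
  have "C n \<subseteq> \<Union>(insert U G)" for n
    using N G(3) by (cases "n < N") (auto simp: not_less)
  then have "insert v (\<Union>n. C n) \<subseteq> \<Union>(insert U G)" using U by blast
  then show "\<exists>G\<subseteq>F. finite G \<and> insert v (\<Union>n. C n) \<subseteq> \<Union>G"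
    using G U by (intro exI[of _ "insert U G"]) auto
qed

text \<open>Shrink the two copies of \<open>A n\<close> and place them near \<open>v\<close> on opposite sides, at distances that tend to 0
  with \<open>n\<close>; the union of all these copies becomes compact when \<open>v\<close> is added.\<close>

lemma countable_compact_containing_two_copies:
  fixes A :: "nat \<Rightarrow> 'n::euclidean_space set" and v :: 'n
  assumes A: "\<And>n. compact (A n)" "\<And>n. countable (A n)" and r: "r > 0"
  obtains B :: "'n set" and f :: "nat \<Rightarrow> bool \<Rightarrow> 'n \<Rightarrow> 'n" where "compact B" "countable B" "B \<noteq> {}" "B \<subseteq> ball v r"
    "\<And>n b. continuous_on (A n) (f n b)" "\<And>n b. inj_on (f n b) (A n)" "\<And>n b. f n b ` A n \<subseteq> B"
    "\<And>n. f n False ` A n \<inter> f n True ` A n = {}"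
proof -
  obtain e :: 'n where e: "norm e = 1" using norm_Basis nonempty_Basis by blast
  have "\<exists>c>0. \<forall>x\<in>A n. norm x \<le> c" for n
    using compact_imp_bounded[OF A(1)] bounded_pos by blast
  then obtain c where c: "\<And>n. c n > 0" "\<And>n x. x \<in> A n \<Longrightarrow> norm x \<le> c n" by metis
  define s where "s n = r / (2 * (real n + 1))" for n
  have s: "s n > 0" "s n \<le> r / 2" for n using r by (auto simp: s_def field_simps)
  define \<sigma> where "\<sigma> b = (if b then 1 else - 1 :: real)" for b
  define f where "f n b x = v + s n *\<^sub>R (\<sigma> b *\<^sub>R e + (1 / (2 * c n)) *\<^sub>R x)" for n b x
  have half: "norm ((1 / (2 * c n)) *\<^sub>R x) \<le> 1 / 2" if "x \<in> A n" for n x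
    using c(1)[of n] c(2)[OF that] by (simp add: field_simps)
  have dist: "dist v (f n b x) \<le> s n * (3 / 2)" if "x \<in> A n" for n b x
  proof -
    have "norm (\<sigma> b *\<^sub>R e + (1 / (2 * c n)) *\<^sub>R x) \<le> 1 + 1 / 2"
      by (rule norm_triangle_le, rule add_mono) (use half[OF that] e in \<open>auto simp: \<sigma>_def\<close>)
    then have "s n * norm (\<sigma> b *\<^sub>R e + (1 / (2 * c n)) *\<^sub>R x) \<le> s n * (3 / 2)"
      using s(1)[of n] by (intro mult_left_mono) auto
    then show ?thesis using s(1)[of n] by (simp add: f_def dist_norm)
  qed
  have cont: "continuous_on (A n) (f n b)" for n b
    unfolding f_def by (intro continuous_intros)
  define C where "C n = f n False ` A n \<union> f n True ` A n" for n
  have C: "C n \<subseteq> ball v d" if "s n * (3 / 2) < d" for n d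
  proof -
    have "f n b x \<in> ball v d" if "x \<in> A n" for b x
      using dist[OF that, of b] \<open>s n * (3 / 2) < d\<close> by (simp only: mem_ball)
    then show ?thesis by (auto simp only: C_def)
  qed
  define B where "B = insert v (\<Union>n. C n)"
  show thesis
  proof (rule that[of B f])
    show "compact B"
      unfolding B_def
    proof (rule compact_sequence_to_point)
      show "compact (C n)" for n
        unfolding C_def using A(1) cont by (intro compact_Un compact_continuous_image)
      fix d :: real assume "d > 0"
      then obtain N where N: "1 / real (Suc N) < d / r" using r nat_approx_posE[of "d / r"] by auto
      have "s n * (3 / 2) < d" if "n \<ge> N" for n
      proof -
        have "s n * (3 / 2) \<le> r * (1 / real (Suc n))" using r by (simp add: s_def field_simps)
        also have "\<dots> \<le> r * (1 / real (Suc N))"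
          using r that by (intro mult_left_mono divide_left_mono) auto
        also have "\<dots> < r * (d / r)" using r N by (intro mult_strict_left_mono)
        finally show ?thesis using r by simp
      qed
      then show "\<exists>N. \<forall>n\<ge>N. C n \<subseteq> ball v d" using C by blast
    qed
    show "countable B"
      unfolding B_def C_def using A(2) by auto
    show "B \<noteq> {}" by (simp add: B_def)
    have "C n \<subseteq> ball v r" for n
      by (rule C) (use s[of n] r in auto)
    then show "B \<subseteq> ball v r" using r by (auto simp: B_def)
    show "inj_on (f n b) (A n)" for n b
      using s(1)[of n] c(1)[of n] by (auto simp: inj_on_def f_def)
    show "f n b ` A n \<subseteq> B" for n b
      by (cases b) (auto simp: B_def C_def)
    show "f n False ` A n \<inter> f n True ` A n = {}" for n
    proof (rule ccontr)
      assume "f n False ` A n \<inter> f n True ` A n \<noteq> {}"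
      then obtain x y where xy: "x \<in> A n" "y \<in> A n" "f n False x = f n True y" by blast
      let ?x = "(1 / (2 * c n)) *\<^sub>R x" and ?y = "(1 / (2 * c n)) *\<^sub>R y"
      have "- e + ?x = e + ?y" using xy(3) s(1)[of n] by (simp add: f_def \<sigma>_def)
      then have "2 *\<^sub>R e = ?x - ?y" by (simp add: scaleR_2 algebra_simps)
      then have "norm (2 *\<^sub>R e) \<le> 1 / 2 + 1 / 2"
        using norm_triangle_ineq4[of ?x ?y] half[OF xy(1)] half[OF xy(2)] by simp
      then show False using e by simp
    qed
  qed (rule cont)
qed

text \<open>The diagonal argument. A set that contains two disjoint copies of each \<open>A n\<close> is
  homeomorphic to none of them, or it would contain two disjoint copies of itself. In particular there are uncountably
  many homeomorphism types of countable compact sets.\<close>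

lemma countable_compact_set_homeomorphic_to_none:
  fixes A :: "nat \<Rightarrow> 'a::heine_borel set" and v :: "'n::euclidean_space"
  assumes c: "homeomorphism U (ball v r) c c'" and r: "r > 0"
    and A: "\<And>n. A n \<subseteq> U" "\<And>n. compact (A n)" "\<And>n. countable (A n)"
  obtains A' where "A' \<subseteq> U" "compact A'" "countable A'" "A' \<noteq> {}" "\<forall>n. \<not> A' homeomorphic A n"
proof -
  have cont: "continuous_on U c" "continuous_on (ball v r) c'" and cinv: "\<And>x. x \<in> U \<Longrightarrow> c' (c x) = x"
    "\<And>z. z \<in> ball v r \<Longrightarrow> c (c' z) = z" and c'U: "c' ` ball v r = U"
    using c by (auto simp: homeomorphism_def)
  have "compact (c ` A n)" "countable (c ` A n)" for n
    using A continuous_on_subset[OF cont(1)] by (auto intro: compact_continuous_image)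
  then obtain B f where B: "compact B" "countable B" "B \<noteq> {}" "B \<subseteq> ball v r"
    and f: "\<And>n b. continuous_on (c ` A n) (f n b)" "\<And>n b. inj_on (f n b) (c ` A n)"
      "\<And>n b. f n b ` (c ` A n) \<subseteq> B" "\<And>n. f n False ` (c ` A n) \<inter> f n True ` (c ` A n) = {}"
    using countable_compact_containing_two_copies[of "\<lambda>n. c ` A n" r v] r by metis
  define A' where "A' = c' ` B"
  have A': "A' \<subseteq> U" "compact A'" "countable A'" "A' \<noteq> {}"
    using B c'U continuous_on_subset[OF cont(2) B(4)] unfolding A'_def
    by (auto intro: compact_continuous_image)
  have "\<not> A' homeomorphic A n" for n
  proof
    assume "A' homeomorphic A n"
    then obtain h h' where h: "homeomorphism A' (A n) h h'" by (auto simp: homeomorphic_def)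
    have hA: "h ` A' = A n" "continuous_on A' h" "inj_on h A'"
      using h by (auto simp: homeomorphism_def intro: inj_on_inverseI[of _ h'])
    define F where "F b = c' \<circ> (f n b \<circ> (c \<circ> h))" for b
    have ch: "(c \<circ> h) ` A' = c ` A n" by (simp only: image_comp[symmetric] hA(1))
    have c'inj: "inj_on c' (ball v r)" by (rule inj_on_inverseI[of _ c]) (rule cinv(2))
    have cinj: "inj_on c U" by (rule inj_on_inverseI[of _ c']) (rule cinv(1))
    have F1: "continuous_on A' (F b)" for b
      unfolding F_def
    proof (intro continuous_on_compose hA(2))
      show "continuous_on (h ` A') c" using hA(1) A(1) continuous_on_subset[OF cont(1)] by simp
      show "continuous_on ((c \<circ> h) ` A') (f n b)" unfolding ch by (rule f(1))
      have "(f n b \<circ> (c \<circ> h)) ` A' = f n b ` (c ` A n)" by (simp only: image_comp[symmetric] hA(1))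
      then show "continuous_on ((f n b \<circ> (c \<circ> h)) ` A') c'"
        using f(3) B(4) continuous_on_subset[OF cont(2)] by (metis subset_trans)
    qed
    have Fim: "F b ` A' = c' ` (f n b ` (c ` A n))" for b
      by (simp only: F_def image_comp[symmetric] hA(1))
    have F2: "inj_on (F b) A'" for b
      unfolding F_def
    proof (intro comp_inj_on hA(3))
      show "inj_on c (h ` A')" using hA(1) A(1) cinj inj_on_subset by metis
      show "inj_on (f n b) ((c \<circ> h) ` A')" unfolding ch by (rule f(2))
      have "(f n b \<circ> (c \<circ> h)) ` A' = f n b ` (c ` A n)" by (simp only: image_comp[symmetric] hA(1))
      then show "inj_on c' ((f n b \<circ> (c \<circ> h)) ` A')"
        using f(3) B(4) c'inj inj_on_subset by (metis subset_trans)
    qed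
    have F3: "F b ` A' \<subseteq> A'" for b
      unfolding Fim unfolding A'_def by (intro image_mono f(3))
    have "F False ` A' \<inter> F True ` A' = c' ` (f n False ` (c ` A n) \<inter> f n True ` (c ` A n))"
      unfolding Fim using f(3) B(4) by (intro inj_on_image_Int[OF c'inj, symmetric]) blast+
    then have "F False ` A' \<inter> F True ` A' = {}" using f(4) by simp
    moreover have "F False ` A' \<inter> F True ` A' \<noteq> {}"
      by (rule countable_compact_no_disjoint_self_embeddings[of A' F])
        (use A' F1 F2 F3 in auto)
    ultimately show False by blast
  qed
  then show thesis using that[OF A'] by blast
qed

section \<open>Cantor sets and locally countable sets\<close>

text \<open>This topologically invariant part recovers a countable set \<open>A\<close> from its union with a disjoint Cantor set.\<close>

definition locally_countable_part :: "'a::topological_space set \<Rightarrow> 'a set" where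
  "locally_countable_part E = {x \<in> E. \<exists>U. open U \<and> x \<in> U \<and> countable (E \<inter> U)}"

lemma homeomorphism_locally_countable_part_subset:
  assumes "homeomorphism E F h k"
  shows "h ` locally_countable_part E \<subseteq> locally_countable_part F"
proof clarify
  fix x assume "x \<in> locally_countable_part E"
  then obtain U where x: "x \<in> E" and U: "open U" "x \<in> U" "countable (E \<inter> U)"
    by (auto simp: locally_countable_part_def)
  have "openin (top_of_set F) (h ` (E \<inter> U))"
    using homeomorphism_imp_open_map[OF assms] U(1) by (simp add: openin_open_Int)
  then obtain V where V: "open V" "h ` (E \<inter> U) = F \<inter> V" unfolding openin_open by blast
  moreover have "countable (F \<inter> V)" unfolding V(2)[symmetric] using U(3) by (rule countable_image)
  moreover have "h x \<in> F \<inter> V" using V(2) x U(2) by blast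
  ultimately show "h x \<in> locally_countable_part F" by (auto simp: locally_countable_part_def)
qed

lemma homeomorphic_locally_countable_parts:
  assumes "homeomorphism E F h k"
  shows "locally_countable_part E homeomorphic locally_countable_part F"
proof -
  have "h ` locally_countable_part E = locally_countable_part F"
  proof
    show "h ` locally_countable_part E \<subseteq> locally_countable_part F"
      by (rule homeomorphism_locally_countable_part_subset[OF assms])
    show "locally_countable_part F \<subseteq> h ` locally_countable_part E"
    proof
      fix y assume y: "y \<in> locally_countable_part F"
      then have "k y \<in> locally_countable_part E"
        using homeomorphism_locally_countable_part_subset[OF homeomorphism_symD[OF assms]] by blast
      moreover have "h (k y) = y"
        using y homeomorphism_apply2[OF assms] by (auto simp: locally_countable_part_def)
      ultimately show "y \<in> h ` locally_countable_part E" by (metis imageI)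
    qed
  qed
  then show ?thesis
    using homeomorphism_of_subsets[OF assms, of "locally_countable_part E" "locally_countable_part F"]
    by (auto simp: homeomorphic_def locally_countable_part_def)
qed

lemma locally_countable_part_Un:
  fixes K :: "'a::t2_space set"
  assumes K: "compact K" "\<And>U. open U \<Longrightarrow> K \<inter> U \<noteq> {} \<Longrightarrow> uncountable (K \<inter> U)"
    and A: "countable A" "K \<inter> A = {}"
  shows "locally_countable_part (K \<union> A) = A"
proof
  show "locally_countable_part (K \<union> A) \<subseteq> A"
  proof
    fix x assume "x \<in> locally_countable_part (K \<union> A)"
    then obtain U where U: "x \<in> K \<union> A" "open U" "x \<in> U" "countable ((K \<union> A) \<inter> U)"
      by (auto simp: locally_countable_part_def)
    then have "countable (K \<inter> U)" by (elim countable_subset[rotated]) blast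
    then show "x \<in> A" using K(2) U by blast
  qed
  show "A \<subseteq> locally_countable_part (K \<union> A)"
  proof
    fix x assume x: "x \<in> A"
    have "countable ((K \<union> A) \<inter> - K)" using A(1) by (rule countable_subset[rotated]) blast
    moreover have "open (- K)" using K(1) compact_imp_closed by blast
    ultimately show "x \<in> locally_countable_part (K \<union> A)"
      using x A(2) unfolding locally_countable_part_def by blast
  qed
qed

abbreviation Cantor_space :: "(nat \<Rightarrow> bool) topology" where
  "Cantor_space \<equiv> product_topology (\<lambda>_. discrete_topology UNIV) UNIV"

lemma connectedin_Cantor_space:
  assumes "connectedin Cantor_space Q" "x \<in> Q" "y \<in> Q"
  shows "x = y"
proof
  fix i
  have "connectedin (discrete_topology UNIV) ((\<lambda>z. z i) ` Q)"
    by (rule connectedin_continuous_map_image[OF continuous_map_product_projection assms(1)]) simp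
  then show "x i = y i" using assms(2,3) by (auto simp: connectedin_discrete_topology)
qed

text \<open>A basic open set prescribes only finitely many terms of a sequence, and leaves the later ones free.\<close>

lemma uncountable_openin_Cantor_space:
  assumes U: "openin Cantor_space U" "U \<noteq> {}"
  shows "uncountable U"
proof
  assume cU: "countable U"
  obtain x where "x \<in> U" using U by blast
  from openin_product_topology_alt[THEN iffD1, OF U(1), rule_format, OF this]
  have "\<exists>V. finite {i. V i \<noteq> (UNIV :: bool set)} \<and> x \<in> Pi\<^sub>E UNIV V \<and> Pi\<^sub>E UNIV V \<subseteq> U"
    by simp
  then obtain V where V: "finite {i. V i \<noteq> (UNIV :: bool set)}" "x \<in> Pi\<^sub>E UNIV V" "Pi\<^sub>E UNIV V \<subseteq> U"
    by (elim exE conjE)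
  from V(1)[unfolded finite_nat_set_iff_bounded]
  obtain m where "\<forall>i\<in>{i. V i \<noteq> UNIV}. i < m" by (rule exE)
  then have m: "V i \<noteq> UNIV \<Longrightarrow> i < m" for i by simp
  define t where "t b = (\<lambda>i. if i < m then x i else b (i - m))" for b :: "nat \<Rightarrow> bool"
  have "inj t"
  proof (rule injI)
    fix b b' assume "t b = t b'"
    then have "t b (i + m) = t b' (i + m)" for i by simp
    then show "b = b'" by (simp add: t_def fun_eq_iff)
  qed
  moreover have "range t \<subseteq> U"
  proof -
    have "t b i \<in> V i" for b i
    proof (cases "i < m")
      case True
      then show ?thesis using V(2) by (simp add: t_def PiE_iff)
    next
      case False
      then have "V i = UNIV" using m by blast
      then show ?thesis by simp
    qed
    then have "range t \<subseteq> Pi\<^sub>E UNIV V" by (auto simp: PiE_iff)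
    with V(3) show ?thesis by (rule order_trans[rotated])
  qed
  ultimately show False
    using uncountable_bool_sequences countable_image_inj_on[of t UNIV] countable_subset[OF _ cU] by metis
qed

lemma totally_disconnected_Cantor_set:
  assumes "top_of_set K homeomorphic_space Cantor_space"
  shows "totally_disconnected K"
  unfolding totally_disconnected_def
proof (intro allI impI)
  fix Q assume Q: "Q \<subseteq> K" "connected Q"
  obtain f g where fg: "homeomorphic_maps (top_of_set K) Cantor_space f g"
    using assms by (auto simp: homeomorphic_space_def)
  then have cf: "continuous_map (top_of_set K) Cantor_space f" and gf: "\<And>x. x \<in> K \<Longrightarrow> g (f x) = x"
    by (auto simp: homeomorphic_maps_def)
  have "connectedin (top_of_set K) Q" using Q by (simp add: connectedin_subtopology)
  then have "connectedin Cantor_space (f ` Q)" using cf by (rule connectedin_continuous_map_image[rotated])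
  then have "x = y" if "x \<in> Q" "y \<in> Q" for x y
    using connectedin_Cantor_space[of "f ` Q" "f x" "f y"] that Q(1) gf by (metis imageI subsetD)
  then show "\<exists>y. Q \<subseteq> {y}" by blast
qed

lemma uncountable_open_Int_Cantor_set:
  assumes hom: "top_of_set K homeomorphic_space Cantor_space" and U: "open U" "K \<inter> U \<noteq> {}"
  shows "uncountable (K \<inter> U)"
proof -
  obtain f where f: "homeomorphic_map (top_of_set K) Cantor_space f"
    using hom by (auto simp: homeomorphic_space)
  have "openin Cantor_space (f ` (K \<inter> U))"
    using f U(1) homeomorphic_imp_open_map open_map_def openin_open_Int by blast
  then have "uncountable (f ` (K \<inter> U))"
    using uncountable_openin_Cantor_space U(2) by blast
  then show ?thesis using countable_image by blast
qed

section \<open>The removed set is determined by the complement\<close>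

lemma connected_ball_chart_minus_countable:
  fixes v :: "'n::euclidean_space"
  assumes dim: "2 \<le> DIM('n)" and c: "homeomorphism U (ball v r) c c'" and r: "r > 0" and A: "countable A"
  shows "connected (U - A)" "U - A \<noteq> {}"
proof -
  have "countable (c ` (U \<inter> A))" using A by auto
  then have con: "connected (ball v r - c ` (U \<inter> A))"
    by (intro connected_open_diff_countable dim) auto
  have eq: "c' ` (ball v r - c ` (U \<inter> A)) = U - A"
  proof
    show "c' ` (ball v r - c ` (U \<inter> A)) \<subseteq> U - A"
    proof (rule image_subsetI)
      fix z assume z: "z \<in> ball v r - c ` (U \<inter> A)"
      have "c' z \<in> U" "c (c' z) = z" using c z unfolding homeomorphism_def by blast+
      then show "c' z \<in> U - A" using z by (metis DiffD2 DiffI IntI imageI)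
    qed
    show "U - A \<subseteq> c' ` (ball v r - c ` (U \<inter> A))"
    proof
      fix x assume x: "x \<in> U - A"
      have cx: "c x \<in> ball v r" "c' (c x) = x" using c x unfolding homeomorphism_def by blast+
      have "c x \<notin> c ` (U \<inter> A)"
      proof
        assume "c x \<in> c ` (U \<inter> A)"
        then obtain a where a: "a \<in> U" "a \<in> A" "c x = c a" by blast
        then have "c' (c a) = a" using c unfolding homeomorphism_def by blast
        then show False using cx(2) a x by simp
      qed
      with cx show "x \<in> c' ` (ball v r - c ` (U \<inter> A))" by (metis DiffI imageI)
    qed
  qed
  have "continuous_on (ball v r - c ` (U \<inter> A)) c'"
    by (rule continuous_on_subset[of "ball v r"]) (use c in \<open>auto simp: homeomorphism_def\<close>)
  then show "connected (U - A)"
    using connected_continuous_image[OF _ con] eq by metis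
  have "uncountable (ball v r)" using r by (rule uncountable_ball)
  then have "ball v r - c ` (U \<inter> A) \<noteq> {}"
    using countable_subset[OF _ \<open>countable (c ` (U \<inter> A))\<close>] by (metis Diff_eq_empty_iff)
  then show "U - A \<noteq> {}" using eq by blast
qed

text \<open>At a point of \<open>T\<close>, a ball minus a countable set is connected. At a point of \<open>K\<close>, the
  compact set \<open>A\<close> can be avoided altogether.\<close>

lemma connected_off_Un_countable:
  fixes S T K :: "'a::t2_space set"
  assumes T: "manifold3 (top_of_set T)" and S: "T \<union> K = S" "T \<inter> K = {}" "openin (top_of_set S) T"
    and K: "\<forall>x\<in>K. connected_off_at S K x"
    and A: "A \<subseteq> T" "compact A" "countable A"
  shows "connected_off S (K \<union> A)"
  unfolding connected_off_def connected_off_at_def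
proof (intro ballI allI impI)
  fix x U assume x: "x \<in> S" and U: "open U" "x \<in> U"
  show "\<exists>W. open W \<and> x \<in> W \<and> W \<subseteq> U \<and> connected (S \<inter> W - (K \<union> A)) \<and> S \<inter> W - (K \<union> A) \<noteq> {}"
  proof (cases "x \<in> K")
    case True
    have "open (U - A)" using U A compact_imp_closed by blast
    moreover have "x \<in> U - A" using True U A S by blast
    ultimately obtain W where W: "open W" "x \<in> W" "W \<subseteq> U - A" "connected (S \<inter> W - K)" "S \<inter> W - K \<noteq> {}"
      using K[rule_format, OF True] unfolding connected_off_at_def by meson
    have "S \<inter> W - (K \<union> A) = S \<inter> W - K" using W(3) by blast
    then have "connected (S \<inter> W - (K \<union> A)) \<and> S \<inter> W - (K \<union> A) \<noteq> {}" using W(4,5) by (simp only: simp_thms)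
    moreover have "W \<subseteq> U" using W(3) by blast
    ultimately show ?thesis using W(1,2) by blast
  next
    case False
    then have "x \<in> T \<inter> U" using x U S by blast
    moreover have "openin (top_of_set T) (T \<inter> U)" using U by (simp add: openin_open_Int)
    ultimately obtain U' c c' and v :: "real^3" and r where U': "openin (top_of_set T) U'" "x \<in> U'" "U' \<subseteq> T \<inter> U" "r > 0"
      "homeomorphism U' (ball v r) c c'"
      using manifold3_set_ball_chart[OF T] by metis
    obtain W0 where W0: "open W0" "U' = S \<inter> W0"
      using openin_trans[OF U'(1) S(3)] unfolding openin_open by blast
    have "S \<inter> (W0 \<inter> U) - (K \<union> A) = U' - A" using W0 U'(3) S by blast
    then have "connected (S \<inter> (W0 \<inter> U) - (K \<union> A)) \<and> S \<inter> (W0 \<inter> U) - (K \<union> A) \<noteq> {}"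
      using connected_ball_chart_minus_countable[OF _ U'(5,4) A(3)] by simp
    moreover have "open (W0 \<inter> U)" "x \<in> W0 \<inter> U" using W0 U U'(2) by auto
    ultimately show ?thesis by blast
  qed
qed

lemma totally_disconnected_Un_countable:
  fixes K A :: "'a::metric_space set"
  assumes K: "totally_disconnected K" "closed K" and A: "countable A" "closed A" "K \<inter> A = {}"
  shows "totally_disconnected (K \<union> A)"
  unfolding totally_disconnected_def
proof (intro allI impI)
  fix Q assume Q: "Q \<subseteq> K \<union> A" "connected Q"
  have "Q \<inter> K = {} \<or> Q \<inter> A = {}"
    using connected_closedD[OF Q(2) _ Q(1) K(2) A(2)] A(3) by blast
  then consider "Q \<subseteq> A" | "Q \<subseteq> K" using Q(1) by blast
  then show "\<exists>y. Q \<subseteq> {y}"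
  proof cases
    case 1
    then have "countable Q" using A(1) countable_subset by blast
    then have "x = y" if "x \<in> Q" "y \<in> Q" for x y
      using connected_uncountable[OF Q(2) that] by blast
    then show ?thesis by blast
  next
    case 2
    then show ?thesis using K(1) Q(2) unfolding totally_disconnected_def by blast
  qed
qed

text \<open>A homeomorphism between \<open>T - A\<close> and \<open>T - B\<close> extends to one of \<open>S\<close> that takes
  \<open>K \<union> A\<close> to \<open>K \<union> B\<close>, hence takes the locally countable part \<open>A\<close> to \<open>B\<close>.\<close>

theorem removed_countable_sets_homeomorphic:
  fixes S T K A B :: "'a::euclidean_space set"
  assumes T: "manifold3 (top_of_set T)" and S: "T \<union> K = S" "T \<inter> K = {}" "openin (top_of_set S) T" "compact S"
    and K: "\<forall>x\<in>K. connected_off_at S K x"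
    and Cantor: "compact K" "top_of_set K homeomorphic_space Cantor_space"
    and A: "A \<subseteq> T" "compact A" "countable A" and B: "B \<subseteq> T" "compact B" "countable B"
    and hom: "(T - A) homeomorphic (T - B)"
  shows "A homeomorphic B"
proof -
  have td: "totally_disconnected (K \<union> D)" if "D \<subseteq> T" "compact D" "countable D" for D
    using totally_disconnected_Un_countable[OF totally_disconnected_Cantor_set[OF Cantor(2)]]
      compact_imp_closed Cantor(1) that S(2) by blast
  have lc: "locally_countable_part (K \<union> D) = D" if "D \<subseteq> T" "countable D" for D
    by (rule locally_countable_part_Un[OF Cantor(1) uncountable_open_Int_Cantor_set[OF Cantor(2)]])
      (use that S in auto)
  have off: "connected_off S (K \<union> D)" if "D \<subseteq> T" "compact D" "countable D" for D
    by (rule connected_off_Un_countable[OF T S(1-3) K that])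
  have eq: "T - D = S - (K \<union> D)" for D using S by blast
  obtain h k where hk: "homeomorphism S S h k" "h ` (K \<union> A) = K \<union> B"
  proof (rule homeomorphism_of_complements_extends)
    show "S - (K \<union> A) homeomorphic S - (K \<union> B)" using hom eq by simp
  qed (use S A B td off in auto)
  then have "homeomorphism (K \<union> A) (K \<union> B) h k"
    by (intro homeomorphism_of_subsets[OF hk(1)]) (use S A B in auto)
  then have "locally_countable_part (K \<union> A) homeomorphic locally_countable_part (K \<union> B)"
    by (rule homeomorphic_locally_countable_parts)
  then show ?thesis using lc A B by simp
qed

text \<open>Replaces \<open>M\<close> by the complement \<open>T\<close> of a Cantor set \<open>K\<close> in \<open>S\<close>, so that metric arguments apply. Of the
  ends, all that is kept is that \<open>K\<close> nowhere locally separates \<open>S\<close>.\<close>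

lemma freudenthal_model_in_compact_set:
  fixes M :: "'a topology" and S :: "'b::euclidean_space set"
  assumes M: "manifold3 M" and hom: "freudenthal M homeomorphic_space top_of_set S" and S: "compact S"
    and C: "C = topspace (freudenthal M) - Inl ` topspace M" "Cantor_set_in (freudenthal M) C"
  obtains T K j j' where "homeomorphic_maps M (top_of_set T) j j'" "T \<union> K = S" "T \<inter> K = {}"
    "openin (top_of_set S) T" "compact K" "top_of_set K homeomorphic_space Cantor_space"
    "\<forall>x\<in>K. connected_off_at S K x"
proof -
  let ?F = "freudenthal M" and ?N = "Inl ` topspace M :: ('a + ('a set \<Rightarrow> 'a set)) set"
  have H: "Hausdorff_space M" and lpc: "locally_path_connected_space M"
    using M manifold3_imp_locally_path_connected by (auto simp: manifold3_def)
  obtain \<Phi> where \<Phi>: "homeomorphic_map ?F (top_of_set S) \<Phi>"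
    using hom by (auto simp: homeomorphic_space)
  have \<Phi>S: "\<Phi> ` topspace ?F = S" using homeomorphic_imp_surjective_map[OF \<Phi>] by simp
  have inj: "inj_on \<Phi> (topspace ?F)" using homeomorphic_imp_injective_map[OF \<Phi>] .
  have op: "openin (top_of_set S) (\<Phi> ` U)" if "openin ?F U" for U
    using homeomorphic_imp_open_map[OF \<Phi>] that by (simp add: open_map_def)
  have Nsub: "?N \<subseteq> topspace ?F" by (auto simp: topspace_freudenthal)
  have Csub: "C \<subseteq> topspace ?F" using C(1) by blast
  define T where "T = \<Phi> ` ?N"
  define K where "K = \<Phi> ` C"
  have TK: "T \<union> K = S" "T \<inter> K = {}"
  proof -
    have "?N \<union> C = topspace ?F" using C(1) Nsub by blast
    then show "T \<union> K = S" using \<Phi>S by (simp add: T_def K_def image_Un[symmetric])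
    have "?N \<inter> C = {}" using C(1) by blast
    then show "T \<inter> K = {}" using inj_on_image_Int[OF inj Nsub Csub] by (simp add: T_def K_def)
  qed
  have "openin ?F ?N"
    unfolding freudenthal_def by (rule topology_generated_by_Basis) blast
  then have Top: "openin (top_of_set S) T" unfolding T_def by (rule op)
  have sub: "homeomorphic_map (subtopology ?F Z) (top_of_set (\<Phi> ` Z)) \<Phi>" if Z: "Z \<subseteq> topspace ?F" for Z
  proof -
    have "\<Phi> ` Z \<subseteq> S" using Z \<Phi>S by blast
    then have "homeomorphic_map (subtopology ?F Z) (subtopology (top_of_set S) (\<Phi> ` Z)) \<Phi>"
      using Z by (intro homeomorphic_map_subtopologies[OF \<Phi>]) (simp add: inf.absorb2)
    then show ?thesis using \<open>\<Phi> ` Z \<subseteq> S\<close> by (simp add: subtopology_subtopology inf.absorb2)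
  qed
  have "homeomorphic_map M (top_of_set T) (\<Phi> \<circ> Inl)"
    unfolding T_def by (rule homeomorphic_map_compose[OF homeomorphic_map_Inl_freudenthal[OF H lpc] sub[OF Nsub]])
  then obtain j' where j': "homeomorphic_maps M (top_of_set T) (\<Phi> \<circ> Inl) j'"
    using homeomorphic_map_maps by blast
  have Kc: "compact K"
  proof -
    have "closedin (top_of_set S) (S - T)" using Top by (intro closedin_diff) auto
    moreover have "S - T = K" using TK by blast
    ultimately show ?thesis using S closedin_compact by metis
  qed
  have KC: "top_of_set K homeomorphic_space Cantor_space"
  proof -
    have "top_of_set K homeomorphic_space subtopology ?F C"
      using homeomorphic_map_imp_homeomorphic_space[OF sub[OF Csub]] homeomorphic_space_sym
      unfolding K_def by blast
    also have "subtopology ?F C homeomorphic_space Cantor_space"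
      using C(2) by (simp add: Cantor_set_in_def)
    finally show ?thesis .
  qed
  have nbhd: "\<exists>W. open W \<and> x \<in> W \<and> W \<subseteq> U \<and> connected (S \<inter> W - K) \<and> S \<inter> W - K \<noteq> {}"
    if x: "x \<in> K" and U: "open U" "x \<in> U" for x U
  proof -
    obtain c where c: "c \<in> C" "x = \<Phi> c" using x by (auto simp: K_def)
    have cF: "c \<in> topspace ?F" "c \<notin> ?N" using c(1) C(1) by blast+
    have opW: "openin ?F {z \<in> topspace ?F. \<Phi> z \<in> S \<inter> U}"
      using homeomorphic_imp_continuous_map[OF \<Phi>] U(1)
      by (intro openin_continuous_map_preimage) (auto simp: openin_open_Int)
    have "\<Phi> c \<in> S" using \<Phi>S cF(1) by (metis imageI)
    then have cW: "c \<in> {z \<in> topspace ?F. \<Phi> z \<in> S \<inter> U}" using cF(1) c(2) U(2) by simp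
    obtain V where V: "openin ?F V" "c \<in> V" "V \<subseteq> {z \<in> topspace ?F. \<Phi> z \<in> S \<inter> U}"
      "connectedin ?F (V \<inter> ?N)" "V \<inter> ?N \<noteq> {}"
      by (rule freudenthal_end_connected_nbhd[OF H lpc opW cW cF(2)])
    have Vsub: "V \<subseteq> topspace ?F" using V(1) openin_subset by blast
    obtain W0 where W0: "open W0" "\<Phi> ` V = S \<inter> W0" using op[OF V(1)] unfolding openin_open by blast
    have "S \<inter> (W0 \<inter> U) = \<Phi> ` V" using W0(2) V(3) by blast
    moreover have "S \<inter> (W0 \<inter> U) - K = (S \<inter> (W0 \<inter> U)) \<inter> T" using TK by blast
    ultimately have "S \<inter> (W0 \<inter> U) - K = \<Phi> ` (V \<inter> ?N)"
      using inj_on_image_Int[OF inj Vsub Nsub] by (simp add: T_def)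
    moreover have "connectedin (top_of_set S) (\<Phi> ` (V \<inter> ?N))"
      by (rule connectedin_continuous_map_image[OF homeomorphic_imp_continuous_map[OF \<Phi>] V(4)])
    then have "connected (\<Phi> ` (V \<inter> ?N))" by (simp add: connectedin_subtopology)
    moreover have "x \<in> W0" using W0(2) V(2) c(2) by blast
    ultimately show ?thesis using W0(1) U V(5) by (intro exI[of _ "W0 \<inter> U"]) auto
  qed
  then have "\<forall>x\<in>K. connected_off_at S K x" unfolding connected_off_at_def by (intro ballI allI impI)
  then show thesis by (rule that[OF j' TK Top Kc KC])
qed

section \<open>Uncountably many manifolds\<close>

text \<open>One representative of each homeomorphism class is chosen; countably many of them would not represent
  all classes. At most one representative is homeomorphic to \<open>M\<close>, and it can be left out.\<close>

lemma uncountable_nonhomeomorphic_family: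
  fixes \<R> :: "'a topology set" and M :: "'a topology"
  assumes new: "\<And>Y :: nat \<Rightarrow> 'a topology. range Y \<subseteq> \<R> \<Longrightarrow> \<exists>X\<in>\<R>. \<forall>n. \<not> X homeomorphic_space Y n"
    and ne: "\<R> \<noteq> {}"
  obtains \<F> where "\<F> \<subseteq> \<R>" "uncountable \<F>" "pairwise (\<lambda>X Y. \<not> X homeomorphic_space Y) \<F>"
    "\<And>X. X \<in> \<F> \<Longrightarrow> \<not> X homeomorphic_space M"
proof -
  define rep where "rep X = (SOME Y. Y \<in> \<R> \<and> X homeomorphic_space Y)" for X :: "'a topology"
  have rep: "rep X \<in> \<R> \<and> X homeomorphic_space rep X" if "X \<in> \<R>" for X
    unfolding rep_def by (rule someI[of _ X]) (simp add: that)
  have rep_eq: "rep X = rep X'" if "X homeomorphic_space X'" for X X'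
  proof -
    have "X homeomorphic_space Y \<longleftrightarrow> X' homeomorphic_space Y" for Y :: "'a topology"
      using that homeomorphic_space_sym homeomorphic_space_trans by blast
    then show ?thesis by (simp add: rep_def)
  qed
  have same: "Y = Y'" if YY: "Y \<in> rep ` \<R>" "Y' \<in> rep ` \<R>" "Y homeomorphic_space Y'" for Y Y'
  proof -
    have "rep Z = Z" if "Z \<in> rep ` \<R>" for Z
      using that rep rep_eq homeomorphic_space_sym by (metis imageE)
    then show ?thesis using YY rep_eq by metis
  qed
  define \<F> where "\<F> = {X \<in> rep ` \<R>. \<not> X homeomorphic_space M}"
  have "uncountable \<F>"
  proof
    assume cF: "countable \<F>"
    have "\<exists>Z. {X \<in> rep ` \<R>. X homeomorphic_space M} \<subseteq> {Z}"
    proof -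
      have "X = Y" if "X \<in> rep ` \<R>" "X homeomorphic_space M" "Y \<in> rep ` \<R>" "Y homeomorphic_space M" for X Y
        using same[OF that(1,3)] that(2,4) homeomorphic_space_sym homeomorphic_space_trans by blast
      then show ?thesis by blast
    qed
    then obtain Z where "{X \<in> rep ` \<R>. X homeomorphic_space M} \<subseteq> {Z}" by (rule exE)
    then have "countable {X \<in> rep ` \<R>. X homeomorphic_space M}"
      by (rule countable_subset) simp
    with cF have "countable (\<F> \<union> {X \<in> rep ` \<R>. X homeomorphic_space M})"
      by (rule countable_Un)
    moreover have "rep ` \<R> \<subseteq> \<F> \<union> {X \<in> rep ` \<R>. X homeomorphic_space M}"
      unfolding \<F>_def by blast
    ultimately have "countable (rep ` \<R>)" by (rule countable_subset[rotated])
    define Y where "Y = from_nat_into (rep ` \<R>)"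
    have Y: "range Y = rep ` \<R>"
      unfolding Y_def using ne \<open>countable (rep ` \<R>)\<close> by (intro range_from_nat_into) simp_all
    have "rep ` \<R> \<subseteq> \<R>" using rep by blast
    with Y have "range Y \<subseteq> \<R>" by (simp only:)
    from new[OF this] obtain X where X: "X \<in> \<R>" "\<forall>n. \<not> X homeomorphic_space Y n" by (rule bexE)
    have "rep X \<in> range Y" unfolding Y using X(1) by (rule imageI)
    then obtain n where "rep X = Y n" by (rule rangeE)
    then show False using rep[OF X(1)] X(2) by metis
  qed
  moreover have "pairwise (\<lambda>X Y. \<not> X homeomorphic_space Y) \<F>"
    using same by (auto simp: pairwise_def \<F>_def)
  moreover have "\<F> \<subseteq> \<R>" using rep by (auto simp: \<F>_def)
  ultimately show thesis using that by (auto simp: \<F>_def)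
qed

theorem theorem1p6:
  fixes M :: "'a topology" and C :: "('a + ('a set \<Rightarrow> 'a set)) set" and N :: nat
  assumes "open_manifold3 M"
    and "freudenthal M homeomorphic_space top_of_set (sphere (0 :: real^4) 1)"
    and "C = topspace (freudenthal M) - Inl ` topspace M"
    and "Cantor_set_in (freudenthal M) C"
    and "N \<ge> 3"
    and "finite {x \<in> C. local_genus (freudenthal M) C x = enat N}"
  shows "\<exists>\<F> :: 'a topology set. uncountable \<F> \<and>
           pairwise (\<lambda>X Y. \<not> X homeomorphic_space Y) \<F> \<and>
           (\<forall>X\<in>\<F>. open_manifold3 X \<and> \<not> X homeomorphic_space M \<and>
             (\<forall>x\<in>topspace X. \<forall>m\<in>topspace M. fundamental_group X x \<cong> fundamental_group M m))"
proof -
  let ?S = "sphere (0 :: real^4) 1"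
  have M3: "manifold3 M" and Mcon: "connected_space M" and Mnc: "\<not> compact_space M"
    using assms(1) by (auto simp: open_manifold3_def)
  obtain T K :: "(real^4) set" and j j' where j: "homeomorphic_maps M (top_of_set T) j j'"
    and TK: "T \<union> K = ?S" "T \<inter> K = {}" "openin (top_of_set ?S) T"
    and K: "compact K" "top_of_set K homeomorphic_space Cantor_space"
      "\<forall>x\<in>K. connected_off_at ?S K x"
    by (rule freudenthal_model_in_compact_set[OF M3 assms(2) compact_sphere assms(3,4)])
  have j'j: "homeomorphic_maps (top_of_set T) M j' j"
    using j by (rule homeomorphic_maps_sym[THEN iffD1])
  have jT: "homeomorphic_map M (top_of_set T) j" using j homeomorphic_maps_map by blast
  have jim: "j ` topspace M = T" using homeomorphic_imp_surjective_map[OF jT] by simp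
  have jinv: "j' (j m) = m" if "m \<in> topspace M" for m
    using j that by (auto simp: homeomorphic_maps_def)
  have MT: "M homeomorphic_space top_of_set T" using j homeomorphic_space_def by blast
  have T3: "manifold3 (top_of_set T)" by (rule manifold3_homeomorphic_space[OF M3 MT])
  have con_iff: "connected_space (top_of_set Z) \<longleftrightarrow> connected Z"
    and pc_iff: "path_connected_space (top_of_set Z) \<longleftrightarrow> path_connected Z"
    and comp_iff: "compact_space (top_of_set Z) \<longleftrightarrow> compact Z" for Z :: "(real^4) set"
    using connectedin_def[of euclidean Z] path_connectedin_def[of euclidean Z] compactin_subspace[of euclidean Z] by simp_all
  have Tcon: "connected T"
    using Mcon homeomorphic_connected_space[OF MT] con_iff by blast
  have Tpc: "path_connected T"
    using path_connected_eq_connected_space[OF manifold3_imp_locally_path_connected[OF T3]] Mcon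
      homeomorphic_connected_space[OF MT] pc_iff by blast
  have "topspace M \<noteq> {}" using Mnc by (auto simp: compact_space_def)
  then obtain t where "t \<in> T" using jim by blast
  then obtain U c c' and v :: "real^3" and r where U: "openin (top_of_set T) U" "U \<subseteq> T" "r > 0"
    and c: "homeomorphism U (ball v r) c c'"
    using manifold3_set_ball_chart[OF T3 openin_topspace] by (metis topspace_euclidean_subtopology)
  have dim: "2 < DIM(real^3)" by simp
  \<comment> \<open>the sets to be removed, all inside one chart U\<close>
  define \<A> where "\<A> = {A. A \<subseteq> U \<and> compact A \<and> countable A \<and> A \<noteq> {}}"
  define X where "X A = subtopology M (j' ` (T - A))" for A
  have XT: "homeomorphic_maps (X A) (top_of_set (T - A)) j j'" for A
  proof -
    have "homeomorphic_maps (X A) (subtopology (top_of_set T) (T - A)) j j'"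
      unfolding X_def
    proof (rule homeomorphic_maps_subtopologies[OF j])
      show "j ` (topspace M \<inter> j' ` (T - A)) = topspace (top_of_set T) \<inter> (T - A)"
        using j jim jinv by (force simp: homeomorphic_maps_def)
    qed
    moreover have "subtopology (top_of_set T) (T - A) = top_of_set (T - A)"
      by (simp add: subtopology_subtopology inf.absorb2)
    ultimately show ?thesis by simp
  qed
  have XT': "X A homeomorphic_space top_of_set (T - A)" for A
    using XT homeomorphic_space_def by blast
  have mfd: "open_manifold3 (X A)" if A: "A \<in> \<A>" for A
    unfolding open_manifold3_def
  proof (intro conjI)
    have AT: "A \<subseteq> T" "compact A" "countable A" "A \<noteq> {}" "A \<subseteq> U" using A U(2) by (auto simp: \<A>_def)
    have cA: "closed A" using AT compact_imp_closed by blast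
    have "openin (top_of_set T) (T - A)"
      using openin_open_Int[of "- A" T] cA by (simp add: Diff_eq open_Compl)
    then have "openin M (j' ` (T - A))"
      using homeomorphic_imp_open_map[of "top_of_set T" M j'] j'j
      unfolding homeomorphic_maps_map open_map_def by simp
    then show "manifold3 (X A)" unfolding X_def by (rule manifold3_open_subset[OF M3])
    have "path_connected (T - A)"
      by (rule path_connected_minus_countable_in_chart[OF dim U(1) open_ball c AT(5,2,3) Tpc])
    then show "connected_space (X A)"
      using homeomorphic_connected_space[OF XT'] path_connected_imp_connected con_iff by blast
    \<comment> \<open>were T - A compact, A and T - A would be closed and disconnect T\<close>
    show "\<not> compact_space (X A)"
    proof
      assume "compact_space (X A)"
      then have "closed (T - A)"
        using homeomorphic_compact_space[OF XT'] compact_imp_closed comp_iff by blast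
      moreover have "T - A \<noteq> {}"
        using connected_ball_chart_minus_countable(2)[OF _ c U(3) AT(3)] U(2) by auto
      ultimately show False
        using connected_closedD[OF Tcon, of A "T - A"] cA AT by blast
    qed
  qed
  have pi1: "fundamental_group (X A) x \<cong> fundamental_group M m"
    if A: "A \<in> \<A>" and x: "x \<in> topspace (X A)" and m: "m \<in> topspace M" for A x m
  proof -
    have "homeomorphic_map (X A) (top_of_set (T - A)) j" using XT homeomorphic_maps_map by blast
    then have "j ` topspace (X A) = T - A" using homeomorphic_imp_surjective_map by fastforce
    then have jx: "j x \<in> T - A" using x by blast
    have jm: "j m \<in> T" using jim m by blast
    have "fundamental_group (X A) x \<cong> fundamental_group (top_of_set (T - A)) (j x)"
      by (rule fundamental_group_homeomorphic_maps(2)[OF XT x loop_calculus_top_of_set])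
    also have "\<dots> \<cong> fundamental_group (top_of_set T) (j x)"
      by (rule fundamental_group_minus_countable_in_chart[OF dim U(1) open_ball c _ _ _ jx])
        (use A in \<open>auto simp: \<A>_def\<close>)
    also have "\<dots> \<cong> fundamental_group (top_of_set T) (j m)"
      using jx jm by (intro fundamental_group_change_base_point[OF Tpc]) auto
    also have "\<dots> \<cong> fundamental_group M (j' (j m))"
    proof (rule fundamental_group_homeomorphic_maps(2)[OF j'j])
      show "loop_calculus M (j' (j m))"
        using fundamental_group_homeomorphic_maps(1)[OF j m loop_calculus_top_of_set] jinv[OF m] by simp
    qed (use jm in simp)
    finally show ?thesis using jinv[OF m] by simp
  qed
  have hom: "A homeomorphic B" if AB: "A \<in> \<A>" "B \<in> \<A>" "X A homeomorphic_space X B" for A B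
  proof (rule removed_countable_sets_homeomorphic[OF T3 TK compact_sphere K(3,1,2)])
    have "top_of_set (T - A) homeomorphic_space top_of_set (T - B)"
      by (rule homeomorphic_space_trans[OF _ homeomorphic_space_trans[OF AB(3) XT']])
        (rule homeomorphic_space_sym[THEN iffD1, OF XT'])
    then show "T - A homeomorphic T - B" by (simp only: homeomorphic_space_top_of_set)
  qed (use AB U(2) in \<open>auto simp: \<A>_def\<close>)
  have new: "\<exists>Z\<in>X ` \<A>. \<forall>n. \<not> Z homeomorphic_space Y n" if Y: "range Y \<subseteq> X ` \<A>" for Y :: "nat \<Rightarrow> 'a topology"
  proof -
    have "\<forall>n. \<exists>A. A \<in> \<A> \<and> Y n = X A"
    proof
      fix n
      have "Y n \<in> X ` \<A>" using Y by (rule subsetD) simp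
      then show "\<exists>A. A \<in> \<A> \<and> Y n = X A" by (rule imageE) blast
    qed
    from choice[OF this] obtain A where A_all: "\<forall>n. A n \<in> \<A> \<and> Y n = X (A n)" by (rule exE)
    then have A: "A n \<in> \<A>" "Y n = X (A n)" for n by simp_all
    have AU: "A n \<subseteq> U" "compact (A n)" "countable (A n)" for n using A(1) by (auto simp: \<A>_def)
    obtain A' where A': "A' \<subseteq> U" "compact A'" "countable A'" "A' \<noteq> {}" "\<forall>n. \<not> A' homeomorphic A n"
      by (rule countable_compact_set_homeomorphic_to_none[OF c U(3) AU])
    then have "A' \<in> \<A>" by (simp add: \<A>_def)
    then have "X A' \<in> X ` \<A>" "\<forall>n. \<not> X A' homeomorphic_space Y n"
      using A'(5) hom A by auto
    then show ?thesis by (intro bexI[of _ "X A'"])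
  qed
  have "{t'} \<in> \<A>" if "t' \<in> U" for t' using that by (simp add: \<A>_def)
  moreover have "U \<noteq> {}" using c U(3) by (auto simp: homeomorphism_def)
  ultimately have "X ` \<A> \<noteq> {}" by blast
  then obtain \<F> where \<F>: "\<F> \<subseteq> X ` \<A>" "uncountable \<F>" "pairwise (\<lambda>X Y. \<not> X homeomorphic_space Y) \<F>"
    "\<And>Z. Z \<in> \<F> \<Longrightarrow> \<not> Z homeomorphic_space M"
    using uncountable_nonhomeomorphic_family[OF new, of M] by metis
  show ?thesis
  proof (intro exI[of _ \<F>] conjI ballI)
    fix Z assume Z: "Z \<in> \<F>"
    then obtain A where A: "A \<in> \<A>" "Z = X A" using \<F>(1) by blast
    show "open_manifold3 Z" using mfd A by simp
    show "\<not> Z homeomorphic_space M" using \<F>(4)[OF Z] .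
    show "fundamental_group Z x \<cong> fundamental_group M m" if "x \<in> topspace Z" "m \<in> topspace M" for x m
      using pi1 A that by simp
  qed (use \<F> in auto)
qed

end
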